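(* Let $n$ and $k$ be integers with $3\leq k\leq n-1$. Then $$\mathrm{ex}(n,C_k,C_n)=\frac{P(n-1,k)}{2k}.$$ Moreover, up to isomorphism, the complete list of extremal graphs ($n$-vertex $C_n$-free graphs containing exactly $\mathrm{ex}(n,C_k,C_n)$ copies of $C_k$) is: $K_{n-1}\cdot K_2$ and $K_{n-1}\cup K_1$ when $(n,k)\neq(5,4)$; and $K_4\cdot K_2$, $K_4\cup K_1$, $K_{2,3}$, and $K_2\vee 3K_1$ when $(n,k)=(5,4)$.
   Context: All graphs are finite and simple. $C_k$ denotes a cycle of length $k$. For graphs $T,H$, the generalized Turán number $\mathrm{ex}(n,T,H)$ is the maximum number of copies of $T$ (subgraphs isomorphic to $T$) in an $n$-vertex $H$-free graph, where $H$-free means containing no (not necessarily induced) subgraph isomorphic to $H$. For integers $n,k$, $P(n,k)=\frac{n!}{(n-k)!}$ if $0\le k\le n$ and $n\ge 1$, and $P(n,k)=0$ if $1\le n<k$ or $k<0$. $K_n$ is the complete graph on $n$ vertices and $K_{m,n}$ is the complete bipartite graph with parts of sizes $m$ and $n$. $K_{n-1}\cdot K_2$ is the graph of order $n$ obtained by identifying a vertex of $K_{n-1}$ with a vertex of $K_2$. For vertex-disjoint graphs $G_1,G_2$, the union $G_1\cup G_2$ has vertex set $V(G_1)\cup V(G_2)$ and edge set $E(G_1)\cup E(G_2)$; $tG$ is the disjoint union of $t$ copies of $G$; the join $G_1\vee G_2$ is obtained from $G_1\cup G_2$ by joining every vertex of $G_1$ to every vertex of $G_2$ by an edge. *)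

theory Defs
  imports Complex_Main "Graph_Theory.Graph_Theory"
begin

text \<open>
  A finite simple graph is a \<^locale>\<open>pair_graph\<close> of the Graph_Theory library: a finite, loopfree,
  symmetric set of arcs, where an undirected edge \<open>uv\<close> is the pair of arcs \<open>(u,v)\<close> and \<open>(v,u)\<close>.
\<close>

definition complete_graph :: "nat \<Rightarrow> nat pair_pre_digraph" where
  "complete_graph n = \<lparr> pverts = {..<n}, parcs = {(u, v). u < n \<and> v < n \<and> u \<noteq> v} \<rparr>"

lemma complete_digraph_complete_graph: "complete_digraph n (with_proj (complete_graph n))"
  by (auto simp: complete_digraph_pair_def complete_graph_def)

text \<open>The graph \<open>C\<^sub>k\<close>; only meaningful for \<open>k \<ge> 3\<close>.\<close>

definition cycle_graph :: "nat \<Rightarrow> nat pair_pre_digraph" where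
  "cycle_graph k = \<lparr> pverts = {..<k},
     parcs = {(u, v). u < k \<and> v < k \<and> (v = Suc u mod k \<or> u = Suc v mod k)} \<rparr>"

definition disjoint_union ::
  "'a pair_pre_digraph \<Rightarrow> 'b pair_pre_digraph \<Rightarrow> ('a + 'b) pair_pre_digraph" where
  "disjoint_union G H = \<lparr> pverts = pverts G <+> pverts H,
     parcs = map_prod Inl Inl ` parcs G \<union> map_prod Inr Inr ` parcs H \<rparr>"

definition multiple_graph :: "nat \<Rightarrow> 'a pair_pre_digraph \<Rightarrow> (nat \<times> 'a) pair_pre_digraph" where
  "multiple_graph t G = \<lparr> pverts = {..<t} \<times> pverts G,
     parcs = {((i, u), (i, v)) | i u v. i < t \<and> (u, v) \<in> parcs G} \<rparr>"

definition graph_join ::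
  "'a pair_pre_digraph \<Rightarrow> 'b pair_pre_digraph \<Rightarrow> ('a + 'b) pair_pre_digraph" where
  "graph_join G H = \<lparr> pverts = pverts (disjoint_union G H),
     parcs = parcs (disjoint_union G H)
       \<union> (Inl ` pverts G) \<times> (Inr ` pverts H) \<union> (Inr ` pverts H) \<times> (Inl ` pverts G) \<rparr>"

text \<open>Identify the vertex \<open>u\<close> of \<open>G\<close> with the vertex \<open>v\<close> of \<open>H\<close> in the disjoint union.\<close>

definition identify_vertices ::
  "'a pair_pre_digraph \<Rightarrow> 'a \<Rightarrow> 'b pair_pre_digraph \<Rightarrow> 'b \<Rightarrow> ('a + 'b) pair_pre_digraph" where
  "identify_vertices G u H v =
     (let q = (\<lambda>x. if x = Inr v then Inl u else x) in
      \<lparr> pverts = q ` pverts (disjoint_union G H),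
        parcs = map_prod q q ` parcs (disjoint_union G H) \<rparr>)"

text \<open>
  \<open>K\<^sub>m \<cdot> K\<^sub>2\<close> for \<open>m \<ge> 1\<close>. Complete graphs are vertex-transitive, so the choice of the identified
  vertices (here 0 and 0) does not matter up to isomorphism.
\<close>

definition complete_pendant :: "nat \<Rightarrow> (nat + nat) pair_pre_digraph" where
  "complete_pendant m = identify_vertices (complete_graph m) 0 (complete_graph 2) 0"

definition graph_iso :: "'a pair_pre_digraph \<Rightarrow> 'b pair_pre_digraph \<Rightarrow> bool" where
  "graph_iso G H \<longleftrightarrow> digraph_iso (with_proj G) (with_proj H)"

definition copies :: "'t pair_pre_digraph \<Rightarrow> 'a pair_pre_digraph \<Rightarrow> 'a pair_pre_digraph set" where
  "copies T G = {S. pair_graph S \<and> subgraph (with_proj S) (with_proj G) \<and> graph_iso S T}"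

definition graph_free :: "'h pair_pre_digraph \<Rightarrow> 'a pair_pre_digraph \<Rightarrow> bool" where
  "graph_free H G \<longleftrightarrow> copies H G = {}"

text \<open>
  Every finite graph is isomorphic to one with vertices in \<^typ>\<open>nat\<close>, so the maximum over these
  graphs is the maximum over all graphs of order \<open>n\<close>.
\<close>

definition gen_turan :: "nat \<Rightarrow> 't pair_pre_digraph \<Rightarrow> 'h pair_pre_digraph \<Rightarrow> nat" where
  "gen_turan n T H =
     Max {card (copies T G) | G :: nat pair_pre_digraph.
            pair_graph G \<and> card (pverts G) = n \<and> graph_free H G}"

definition gen_turan_extremal ::
  "nat \<Rightarrow> 't pair_pre_digraph \<Rightarrow> 'h pair_pre_digraph \<Rightarrow> 'a pair_pre_digraph \<Rightarrow> bool" where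
  "gen_turan_extremal n T H G \<longleftrightarrow>
     pair_graph G \<and> card (pverts G) = n \<and> graph_free H G \<and> card (copies T G) = gen_turan n T H"

definition perm_count :: "int \<Rightarrow> int \<Rightarrow> real" where
  "perm_count n k =
     (if 0 \<le> k \<and> k \<le> n \<and> 1 \<le> n then fact (nat n) / fact (nat (n - k)) else 0)"

end

theory Submission
  imports Defs
begin

text \<open>
  A copy of \<open>C\<^sub>k\<close> in \<open>G\<close> is traced by exactly \<open>2 k\<close> closed sequences, that is, sequences of \<open>k\<close>
  distinct vertices that are cyclically consecutively adjacent (\<open>card_closed_seqs_eq_copies\<close>). So the
  theorem says that a graph of order \<open>n\<close> without Hamiltonian cycle has at most \<open>P(n-1,k)\<close> closed
  sequences, as many as there are sequences of \<open>k\<close> distinct elements that avoid one fixed vertex. If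
  some vertex has degree at most 1, then every closed sequence avoids it; the bound is immediate, and
  equality means that the other \<open>n-1\<close> vertices are pairwise adjacent. This gives the two general
  extremal graphs. It remains to see that all other non-Hamiltonian graphs stay strictly below the
  bound, except for \<open>K\<^bsub>2,3\<^esub>\<close> and \<open>K\<^sub>2 \<or> 3K\<^sub>1\<close> when \<open>(n,k) = (5,4)\<close>.

  The counting is done one vertex at a time. A closed sequence that starts at \<open>u\<close> is a path from \<open>u\<close>
  to \<open>u\<close> through \<open>V - {u}\<close>, so the right object is the number of paths with \<open>s\<close> inner vertices in a
  set \<open>V\<close> between two vertices \<open>a\<close>, \<open>b\<close> outside \<open>V\<close>. If no such path uses all of \<open>V\<close>, then there are
  at most \<open>P(|V|-1,s)\<close> of them (\<open>card_inner_paths_le\<close>). Indeed, if \<open>a\<close> misses a vertex of \<open>V\<close>, there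
  are at most \<open>|V|-1\<close> choices for the first inner vertex \<open>c\<close>, and the rest is a path from \<open>c\<close> to \<open>b\<close>
  through \<open>V - {c}\<close>, which again cannot use everything; the same works for \<open>b\<close> after a reversal. If both
  ends are adjacent to all of \<open>V\<close>, then \<open>V\<close> has no Hamiltonian path, and after removing two vertices
  instead of one the claim becomes an upper bound for the number of edges of such a graph (for
  \<open>s = 3\<close>, for the number of its paths with three vertices). Applied at every vertex of a
  non-Hamiltonian graph, the path bound yields \<open>card_closed_seqs_le_degrees\<close>: the number of closed
  sequences is at most \<open>P(n-3,k-2)\<close> times the sum of the numbers \<open>min (deg v) (n-2)\<close>.

  Thus everything is reduced to degree sums, and these are controlled by a theorem in the style of
  Chvatal and Posa (\<open>nonhamiltonian_degrees\<close>): in a non-Hamiltonian graph there is an \<open>h\<close> with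
  \<open>1 \<le> h < n/2\<close> such that \<open>h\<close> vertices have degree at most \<open>h\<close> and all but \<open>h\<close> of the others have degree
  at most \<open>n-h-1\<close>. The case \<open>h = 1\<close> is the one of a vertex of degree at most 1. For \<open>h \<ge> 2\<close> the sum above
  is less than \<open>(n-1)(n-2)\<close> unless \<open>n = 5\<close> and \<open>h = 2\<close>, and \<open>(n-1)(n-2) P(n-3,k-2) = P(n-1,k)\<close>. In the
  remaining case triangles stay below the bound, and equality for \<open>k = 4\<close> forces three vertices of
  degree 2 and two of degree at least 3, which leaves only the two sporadic graphs.
\<close>

section \<open>Sequences of distinct vertices\<close>

text \<open>
  The number \<open>P(m,s)\<close>, with the recursion that corresponds to fixing the first entry of a sequence.
\<close>

primrec falling :: "nat \<Rightarrow> nat \<Rightarrow> nat" where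
  "falling m 0 = 1"
| "falling m (Suc s) = m * falling (m - 1) s"

definition degree :: "('a \<Rightarrow> 'a \<Rightarrow> bool) \<Rightarrow> 'a set \<Rightarrow> 'a \<Rightarrow> nat" where
  "degree E V v = card {u \<in> V. E v u}"

text \<open>
  Here and below a graph is a symmetric irreflexive relation \<open>E\<close> together with a vertex set. The ends
  \<open>a\<close> and \<open>b\<close> of the path lie outside \<open>V\<close> and may coincide; then the path closes up to a cycle.
\<close>

definition inner_paths :: "('a \<Rightarrow> 'a \<Rightarrow> bool) \<Rightarrow> 'a set \<Rightarrow> nat \<Rightarrow> 'a \<Rightarrow> 'a \<Rightarrow> 'a list set" where
  "inner_paths E V s a b =
     {xs. length xs = s \<and> distinct xs \<and> set xs \<subseteq> V \<and> successively E (a # xs @ [b])}"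

definition closed_seqs :: "('a \<Rightarrow> 'a \<Rightarrow> bool) \<Rightarrow> 'a set \<Rightarrow> nat \<Rightarrow> 'a list set" where
  "closed_seqs E V k =
     {xs. length xs = k \<and> distinct xs \<and> set xs \<subseteq> V \<and> successively E (xs @ [hd xs])}"

definition traceable :: "('a \<Rightarrow> 'a \<Rightarrow> bool) \<Rightarrow> 'a set \<Rightarrow> bool" where
  "traceable E V \<longleftrightarrow> (\<exists>xs. distinct xs \<and> set xs = V \<and> successively E xs)"

definition hamiltonian :: "('a \<Rightarrow> 'a \<Rightarrow> bool) \<Rightarrow> 'a set \<Rightarrow> bool" where
  "hamiltonian E V \<longleftrightarrow> closed_seqs E V (card V) \<noteq> {}"

lemma hamiltonian_iff:
  assumes "finite V"
  shows "hamiltonian E V \<longleftrightarrow> (\<exists>xs. distinct xs \<and> set xs = V \<and> successively E (xs @ [hd xs]))"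
  unfolding hamiltonian_def closed_seqs_def using assms
  by (auto simp: distinct_card) (metis card_subset_eq distinct_card)

lemma successively_closed_nth:
  assumes "xs \<noteq> []"
  shows "successively E (xs @ [hd xs]) \<longleftrightarrow>
           (\<forall>i<length xs. E (xs ! i) (xs ! (Suc i mod length xs)))"
proof -
  have *: "(xs @ [hd xs]) ! i = xs ! (i mod length xs)" if "i \<le> length xs" for i
    using that assms by (cases "i = length xs") (auto simp: nth_append hd_conv_nth)
  have "successively E (xs @ [hd xs]) \<longleftrightarrow>
          (\<forall>i<length xs. E ((xs @ [hd xs]) ! i) ((xs @ [hd xs]) ! Suc i))"
    by (auto simp: successively_conv_nth)
  also have "\<dots> \<longleftrightarrow> (\<forall>i<length xs. E (xs ! i) (xs ! (Suc i mod length xs)))"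
    using *[of "Suc _"] assms by (intro all_cong) (simp add: * Suc_le_eq)
  finally show ?thesis .
qed

lemma successively_closed_rotate:
  assumes "xs \<noteq> []" and "successively E (xs @ [hd xs])"
  shows "successively E (rotate m xs @ [hd (rotate m xs)])"
proof -
  have "E (rotate m xs ! i) (rotate m xs ! (Suc i mod length xs))" if "i < length xs" for i
  proof -
    have "E (xs ! ((m + i) mod length xs)) (xs ! (Suc ((m + i) mod length xs) mod length xs))"
      using assms that by (simp add: successively_closed_nth)
    moreover have "Suc ((m + i) mod length xs) mod length xs
                     = (m + Suc i mod length xs) mod length xs"
      by (simp add: mod_Suc_eq mod_add_right_eq)
    moreover have "Suc i mod length xs < length xs" using assms by simp
    ultimately show ?thesis using that by (simp add: nth_rotate)
  qed
  then show ?thesis using assms by (subst successively_closed_nth) auto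
qed

section \<open>Degrees in graphs without Hamiltonian cycle\<close>

lemma degree_mono:
  assumes "finite V" and "\<And>x y. E x y \<Longrightarrow> F x y"
  shows "degree E V v \<le> degree F V v"
  unfolding degree_def using assms by (intro card_mono) auto

lemma degree_le:
  assumes "finite V" "irreflp E" "v \<in> V"
  shows "degree E V v \<le> card V - 1"
proof -
  have "{u \<in> V. E v u} \<subseteq> V - {v}" using assms by (auto simp: irreflp_def)
  then have "degree E V v \<le> card (V - {v})"
    unfolding degree_def using assms by (intro card_mono) auto
  then show ?thesis using assms by simp
qed

text \<open>
  The rotation argument. If the first vertex \<open>u\<close> of a Hamiltonian path is adjacent to the vertex at
  position \<open>i + 1\<close> and the last vertex \<open>v\<close> to the one at position \<open>i\<close>, then reversing the part after
  position \<open>i\<close> gives a Hamiltonian cycle. So the neighbours of \<open>u\<close> (shifted by one) and those of \<open>v\<close>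
  occupy disjoint sets of positions among the first \<open>n - 1\<close>.
\<close>

lemma degree_sum_path_ends:
  assumes sym: "symp E" and irr: "irreflp E"
    and p: "distinct p" "successively E p" "p \<noteq> []"
    and nonham: "\<not> hamiltonian E (set p)"
  shows "degree E (set p) (hd p) + degree E (set p) (last p) < length p"
proof -
  define n where "n = length p"
  define S where "S = {i. Suc i < n \<and> E (hd p) (p ! Suc i)}"
  define T where "T = {i. Suc i < n \<and> E (last p) (p ! i)}"
  have n: "n > 0" using p by (simp add: n_def)
  have hd: "hd p = p ! 0" and last: "last p = p ! (n - 1)"
    using p by (auto simp: hd_conv_nth last_conv_nth n_def)
  have inj: "inj_on ((!) p) {..<n}" using p by (simp add: n_def inj_on_nth)
  have "{u \<in> set p. E (hd p) u} = (\<lambda>i. p ! Suc i) ` S"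
  proof (intro equalityI subsetI)
    fix u assume "u \<in> {u \<in> set p. E (hd p) u}"
    then obtain j where j: "j < n" "p ! j = u" "E (hd p) u"
      by (auto simp: in_set_conv_nth n_def)
    then have "j \<noteq> 0" using irr hd by (auto simp: irreflp_def intro: gr0I)
    then obtain i where "j = Suc i" by (cases j) auto
    then show "u \<in> (\<lambda>i. p ! Suc i) ` S" using j by (auto simp: S_def)
  qed (auto simp: S_def n_def)
  moreover have "inj_on (\<lambda>i. p ! Suc i) S"
    using inj by (auto simp: inj_on_def S_def)
  ultimately have dS: "degree E (set p) (hd p) = card S"
    by (simp add: degree_def card_image)
  have "{u \<in> set p. E (last p) u} = (!) p ` T"
  proof (intro equalityI subsetI)
    fix u assume "u \<in> {u \<in> set p. E (last p) u}"
    then obtain j where j: "j < n" "p ! j = u" "E (last p) u"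
      by (auto simp: in_set_conv_nth n_def)
    then have "j \<noteq> n - 1" using irr last by (auto simp: irreflp_def)
    then show "u \<in> (!) p ` T" using j by (auto simp: T_def)
  qed (auto simp: T_def n_def)
  moreover have "inj_on ((!) p) T"
    by (rule inj_on_subset[OF inj]) (auto simp: T_def)
  ultimately have dT: "degree E (set p) (last p) = card T"
    by (simp add: degree_def card_image)
  have "S \<inter> T = {}"
  proof (rule ccontr)
    assume "S \<inter> T \<noteq> {}"
    then obtain i where i: "Suc i < n" "E (hd p) (p ! Suc i)" "E (last p) (p ! i)"
      by (auto simp: S_def T_def)
    define xs where "xs = take (Suc i) p @ rev (drop (Suc i) p)"
    have dne: "drop (Suc i) p \<noteq> []" "take (Suc i) p \<noteq> []" using i n by (auto simp: n_def)
    have "set xs = set p" "distinct xs"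
      using p(1) set_append[of "take (Suc i) p" "drop (Suc i) p"]
        distinct_append[of "take (Suc i) p" "drop (Suc i) p"]
      by (auto simp: xs_def simp del: set_append distinct_append) 
        (auto simp: set_append distinct_append)
    moreover have "successively E (xs @ [hd xs])"
    proof -
      have hdxs: "hd xs = hd p" using dne by (simp add: xs_def hd_append)
      have s: "successively E (take (Suc i) p)" "successively E (drop (Suc i) p)"
        using p(2) successively_append_iff[of E "take (Suc i) p" "drop (Suc i) p"] by auto
      have "successively E (rev (drop (Suc i) p))"
        using s(2) sym by (auto simp: symp_def elim: successively_mono)
      moreover have "last (take (Suc i) p) = p ! i"
        using i by (simp add: take_Suc_conv_app_nth n_def)
      moreover have "hd (rev (drop (Suc i) p)) = last p"
        using i by (simp add: hd_rev last_drop n_def)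
      moreover have "last (rev (drop (Suc i) p)) = p ! Suc i"
        using i by (simp add: last_rev hd_drop_conv_nth n_def)
      ultimately show ?thesis using s(1) i sym dne
        unfolding hdxs by (auto simp: xs_def successively_append_iff symp_def)
    qed
    ultimately show False using nonham by (auto simp: hamiltonian_iff)
  qed
  then have "card S + card T = card (S \<union> T)"
    by (intro card_Un_disjoint[symmetric])
      (auto simp: S_def T_def intro: finite_subset[of _ "{..<n}"])
  also have "\<dots> \<le> card {..<n - 1}" by (intro card_mono) (auto simp: S_def T_def)
  finally show ?thesis using n dS dT by (simp only: card_lessThan n_def)
qed

text \<open>
  Degree bounds pass to subgraphs, so a non-Hamiltonian graph may be enlarged until
  every further edge would create a Hamiltonian cycle.
\<close>

lemma ex_saturated_supergraph:
  assumes fin: "finite V" and E: "symp E" "irreflp E" "\<not> hamiltonian E V"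
  shows "\<exists>F. symp F \<and> irreflp F \<and> (\<forall>x y. E x y \<longrightarrow> F x y) \<and> \<not> hamiltonian F V \<and>
     (\<forall>u\<in>V. \<forall>v\<in>V. u \<noteq> v \<longrightarrow> \<not> F u v \<longrightarrow>
        hamiltonian (\<lambda>x y. F x y \<or> (x = u \<and> y = v) \<or> (x = v \<and> y = u)) V)"
proof -
  define P where "P F \<longleftrightarrow> symp F \<and> irreflp F \<and> (\<forall>x y. E x y \<longrightarrow> F x y) \<and> \<not> hamiltonian F V" for F
  define m where "m F = card {(x, y) \<in> V \<times> V. F x y}" for F :: "'a \<Rightarrow> 'a \<Rightarrow> bool"
  have "m F \<le> card (V \<times> V)" for F
    unfolding m_def using fin by (intro card_mono) auto
  then have bound: "\<forall>F. P F \<longrightarrow> m F < Suc (card (V \<times> V))" by (auto simp: less_Suc_eq_le)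
  have "P E" using E by (auto simp: P_def)
  then obtain F where F: "P F" "\<forall>F'. P F' \<longrightarrow> m F' \<le> m F"
    using ex_has_greatest_nat[of P E m, OF _ bound] by auto
  have "hamiltonian (\<lambda>x y. F x y \<or> (x = u \<and> y = v) \<or> (x = v \<and> y = u)) V" (is "hamiltonian ?F V")
    if "u \<in> V" "v \<in> V" "u \<noteq> v" "\<not> F u v" for u v
  proof (rule ccontr)
    assume "\<not> hamiltonian ?F V"
    then have "P ?F" using F(1) that by (auto simp: P_def symp_def irreflp_def)
    then have "m ?F \<le> m F" using F by blast
    moreover have "m F < m ?F"
      unfolding m_def using fin that by (intro psubset_card_mono) (auto intro: finite_subset)
    ultimately show False by simp
  qed
  then show ?thesis using F(1) unfolding P_def by blast
qed

text \<open>
  The Hamiltonian cycle created by the new edge \<open>uv\<close> must use it; cutting it there leaves a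
  Hamiltonian path from \<open>u\<close> to \<open>v\<close> in the old graph.
\<close>

lemma degree_sum_saturated:
  assumes F: "symp F" "irreflp F" "\<not> hamiltonian F V" and fin: "finite V" and n: "card V \<ge> 3"
    and uv: "u \<in> V" "v \<in> V" "\<not> F u v"
    and ham: "hamiltonian (\<lambda>x y. F x y \<or> (x = u \<and> y = v) \<or> (x = v \<and> y = u)) V"
  shows "degree F V u + degree F V v < card V"
proof -
  let ?F = "\<lambda>x y. F x y \<or> (x = u \<and> y = v) \<or> (x = v \<and> y = u)"
  obtain xs where xs: "distinct xs" "set xs = V" "successively ?F (xs @ [hd xs])"
    using ham by (auto simp: hamiltonian_iff[OF fin])
  have len: "length xs = card V" using xs distinct_card by metis
  have ne: "xs \<noteq> []" using len n by auto
  have "\<not> successively F (xs @ [hd xs])"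
    using F(3) xs(1,2) by (auto simp: hamiltonian_iff[OF fin])
  then obtain i where i: "i < length xs" "\<not> F (xs ! i) (xs ! (Suc i mod length xs))"
    by (auto simp: successively_closed_nth[OF ne])
  \<comment> \<open>Rotate the cycle so that the new edge joins the last entry to the first one.\<close>
  define ys where "ys = rotate (Suc i) xs"
  have ys: "distinct ys" "set ys = V" "length ys = card V" "ys \<noteq> []"
    using xs len ne by (auto simp: ys_def)
  have cl: "successively ?F (ys @ [hd ys])"
    unfolding ys_def using successively_closed_rotate[OF ne xs(3)] .
  have hd: "hd ys = xs ! (Suc i mod length xs)"
    unfolding ys_def using ne by (simp only: hd_rotate_conv_nth not_False_eq_True)
  have "ys ! (length ys - 1) = xs ! ((Suc i + (length xs - 1)) mod length xs)"
    using ne unfolding ys_def by (subst nth_rotate) auto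
  also have "Suc i + (length xs - 1) = i + length xs" using ne by (cases xs) auto
  finally have last: "last ys = xs ! i" using i ys(4) by (simp add: last_conv_nth)
  have nF: "\<not> F (last ys) (hd ys)" using i by (simp add: hd last)
  have uv': "{last ys, hd ys} = {u, v}"
  proof -
    have "?F (last ys) (hd ys)" using cl ys by (auto simp: successively_append_iff)
    then show ?thesis using nF by auto
  qed
  have "successively F ys"
    unfolding successively_conv_nth
  proof (intro allI impI)
    fix j assume j: "Suc j < length ys"
    have "?F (ys ! j) (ys ! Suc j)"
      using successively_nth[of ?F ys j] cl j unfolding successively_append_iff by blast
    moreover have "{ys ! j, ys ! Suc j} \<noteq> {last ys, hd ys}"
    proof
      assume "{ys ! j, ys ! Suc j} = {last ys, hd ys}"
      then have "{ys ! j, ys ! Suc j} = {ys ! (length ys - 1), ys ! 0}"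
        using ys(4) by (simp add: hd_conv_nth last_conv_nth)
      then show False using j ys(1,3) n
        by (auto simp: doubleton_eq_iff nth_eq_iff_index_eq)
    qed
    ultimately show "F (ys ! j) (ys ! Suc j)" using uv' by auto
  qed
  from degree_sum_path_ends[OF F(1,2) ys(1) this ys(4)]
  have "degree F V (hd ys) + degree F V (last ys) < card V"
    using F(3) ys by simp
  then show ?thesis using uv' by (auto simp: doubleton_eq_iff)
qed

lemma successively_closed_complete:
  assumes "distinct xs" and "2 \<le> length xs"
    and "\<And>u v. u \<in> set xs \<Longrightarrow> v \<in> set xs \<Longrightarrow> u \<noteq> v \<Longrightarrow> E u v"
  shows "successively E (xs @ [hd xs])"
proof -
  have ne: "xs \<noteq> []" using assms(2) by auto
  have "E (xs ! i) (xs ! (Suc i mod length xs))" if i: "i < length xs" for i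
  proof (rule assms(3))
    have lt: "Suc i mod length xs < length xs" using ne by simp
    show "xs ! i \<in> set xs" "xs ! (Suc i mod length xs) \<in> set xs" using i lt nth_mem by blast+
    have "Suc i mod length xs \<noteq> i" using i assms(2) by (cases "Suc i = length xs") auto
    then show "xs ! i \<noteq> xs ! (Suc i mod length xs)"
      using i lt assms(1) by (simp add: nth_eq_iff_index_eq)
  qed
  then show ?thesis by (simp add: successively_closed_nth[OF ne])
qed

lemma hamiltonian_complete:
  assumes "finite V" and "card V \<ge> 2" and "\<And>u v. u \<in> V \<Longrightarrow> v \<in> V \<Longrightarrow> u \<noteq> v \<Longrightarrow> E u v"
  shows "hamiltonian E V"
proof -
  obtain xs where xs: "set xs = V" "distinct xs" using assms(1) finite_distinct_list by blast
  moreover have "2 \<le> length xs" using assms(2) xs distinct_card by metis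
  ultimately have "successively E (xs @ [hd xs])"
    using assms(3) by (intro successively_closed_complete) auto
  then show ?thesis using xs by (auto simp: hamiltonian_iff[OF assms(1)])
qed

text \<open>
  In a saturated graph, choose nonadjacent \<open>u\<close>, \<open>v\<close> with the largest degree sum, \<open>deg u \<le> deg v\<close>, and
  put \<open>h = deg u\<close>. Since \<open>deg u + deg v < n\<close>, at least \<open>h\<close> vertices other than \<open>v\<close> are not adjacent
  to \<open>v\<close>; by maximality each of them has degree at most \<open>h\<close>. Likewise the vertices not adjacent to
  \<open>u\<close> have degree at most \<open>deg v \<le> n-h-1\<close>, so only the \<open>h\<close> neighbours of \<open>u\<close> are unrestricted.
\<close>

theorem nonhamiltonian_degrees:
  assumes fin: "finite V" and n: "card V \<ge> 3"
    and E: "symp E" "irreflp E" "\<not> hamiltonian E V"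
  obtains h R T where "1 \<le> h" "2 * h < card V" "R \<subseteq> V" "T \<subseteq> V" "R \<inter> T = {}"
    "card R = h" "card T = h" "\<And>v. v \<in> R \<Longrightarrow> degree E V v \<le> h"
    "\<And>v. v \<in> V - R - T \<Longrightarrow> degree E V v \<le> card V - h - 1"
proof -
  obtain F where F: "symp F" "irreflp F" "\<not> hamiltonian F V" and EF: "\<And>x y. E x y \<Longrightarrow> F x y"
    and sat: "\<And>u v. u \<in> V \<Longrightarrow> v \<in> V \<Longrightarrow> u \<noteq> v \<Longrightarrow> \<not> F u v \<Longrightarrow>
        hamiltonian (\<lambda>x y. F x y \<or> (x = u \<and> y = v) \<or> (x = v \<and> y = u)) V"
    using ex_saturated_supergraph[OF fin E] by blast
  let ?d = "degree F V"
  have dEF: "degree E V x \<le> ?d x" for x using degree_mono[OF fin, of E F] EF by blast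
  define Q where "Q = {(u, v). u \<in> V \<and> v \<in> V \<and> u \<noteq> v \<and> \<not> F u v}"
  have "finite Q" by (rule finite_subset[of _ "V \<times> V"]) (auto simp: Q_def fin)
  moreover have "Q \<noteq> {}"
    using hamiltonian_complete[OF fin, of F] F(3) n by (force simp: Q_def)
  ultimately have finQ: "finite ((\<lambda>r. ?d (fst r) + ?d (snd r)) ` Q)"
    "(\<lambda>r. ?d (fst r) + ?d (snd r)) ` Q \<noteq> {}" by auto
  obtain q where q: "q \<in> Q" "\<And>r. r \<in> Q \<Longrightarrow> ?d (fst r) + ?d (snd r) \<le> ?d (fst q) + ?d (snd q)"
    using Max_in[OF finQ] Max_ge[OF finQ(1)] by (metis (no_types, lifting) image_iff)
  obtain u v where uv: "u \<in> V" "v \<in> V" "u \<noteq> v" "\<not> F u v" "?d u \<le> ?d v"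
    and max: "\<And>x y. x \<in> V \<Longrightarrow> y \<in> V \<Longrightarrow> x \<noteq> y \<Longrightarrow> \<not> F x y \<Longrightarrow> ?d x + ?d y \<le> ?d u + ?d v"
  proof (cases "?d (fst q) \<le> ?d (snd q)")
    case True
    show ?thesis
      by (rule that[of "fst q" "snd q"]) (use q True in \<open>auto simp: Q_def\<close>)
  next
    case False
    show ?thesis
      by (rule that[of "snd q" "fst q"]) (use q False F(1) in \<open>auto simp: Q_def symp_def add.commute\<close>)
  qed
  have sum: "?d u + ?d v < card V"
    using degree_sum_saturated[OF F fin n uv(1,2,4) sat] uv by blast
  define h where "h = ?d u"
  have h2: "2 * h < card V" using sum uv(5) by (simp add: h_def)
  show ?thesis
  proof (cases "h = 0")
    case True
    \<comment> \<open>An isolated \<open>u\<close> plays the part of a vertex of degree at most 1; all degrees are at most \<open>n - 2\<close>.\<close>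
    have "card (V - {u}) \<noteq> 0" using n uv fin by simp
    then obtain t where t: "t \<in> V" "t \<noteq> u" by (metis DiffE all_not_in_conv card.empty insertI1)
    have "\<not> F u x" if "x \<in> V" for x
      using True that fin by (auto simp: h_def degree_def)
    then have "{y \<in> V. F x y} \<subseteq> V - {u, x}" if "x \<in> V" for x
      using F that by (auto simp: symp_def irreflp_def)
    then have "?d x \<le> card (V - {u, x})" if "x \<in> V" for x
      unfolding degree_def using fin that by (intro card_mono) auto
    then have "?d x \<le> card V - 1 - 1" if "x \<in> V - {u} - {t}" for x
    proof -
      have "card (V - {u, x}) = card V - 1 - 1"
        using that fin uv by (auto simp: card_Diff_subset card_insert_if)
      then show ?thesis using \<open>x \<in> V \<Longrightarrow> ?d x \<le> card (V - {u, x})\<close> that by simp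
    qed
    then have "degree E V x \<le> card V - 1 - 1" if "x \<in> V - {u} - {t}" for x
      using dEF[of x] that le_trans by blast
    moreover have "degree E V u \<le> 1" using dEF[of u] True by (simp add: h_def)
    ultimately show ?thesis using t uv n by (intro that[of 1 "{u}" "{t}"]) auto
  next
    case False
    define R0 where "R0 = {x \<in> V. x \<noteq> v \<and> \<not> F v x}"
    have "R0 = V - insert v {x \<in> V. F v x}" by (auto simp: R0_def)
    then have "card R0 = card V - Suc (?d v)"
      using fin uv F(2) by (simp add: card_Diff_subset degree_def irreflp_def)
    then have "h \<le> card R0" using sum by (simp add: h_def)
    then obtain R where R: "R \<subseteq> R0" "card R = h" using obtain_subset_with_card_n by blast
    have RV: "R \<subseteq> V" using R by (auto simp: R0_def)
    have finR: "finite R" using RV fin finite_subset by blast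
    have dR: "?d x \<le> h" if "x \<in> R" for x
      using max[of v x] that R uv by (auto simp: R0_def h_def)
    define N where "N = {x \<in> V. F u x}"
    have N: "card N = h" "N \<subseteq> V" by (auto simp: N_def h_def degree_def)
    \<comment> \<open>Neighbours of \<open>u\<close> may lie in \<open>R\<close>; then \<open>T\<close> is filled up to size \<open>h\<close> arbitrarily.\<close>
    have "card (N - R) \<le> h" using N fin by (metis card_mono Diff_subset finite_subset)
    moreover have "card (V - R) \<ge> h" using RV R h2 finR by (simp add: card_Diff_subset)
    ultimately obtain T where T: "N - R \<subseteq> T" "T \<subseteq> V - R" "card T = h"
      using exists_subset_between[of "N - R" h "V - R"] N fin by auto
    have "?d x \<le> card V - h - 1" if "x \<in> V - R - T" for x
    proof (cases "x = u")
      case True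
      then show ?thesis using h2 by (simp add: h_def)
    next
      case False
      have "\<not> F u x" using that T by (auto simp: N_def)
      then have "?d x \<le> ?d v" using max[of u x] that uv False by auto
      then show ?thesis using sum by (simp add: h_def)
    qed
    then show ?thesis using RV R T h2 False dR dEF
      by (intro that[of h R T]) (auto intro: le_trans[OF dEF])
  qed
qed

lemma degree_sum_bound:
  fixes f :: "nat \<Rightarrow> nat"
  assumes fin: "finite V" and RT: "R \<subseteq> V" "T \<subseteq> V" "R \<inter> T = {}"
    and d: "\<And>v. v \<in> R \<Longrightarrow> f (d v) \<le> a" "\<And>v. v \<in> T \<Longrightarrow> f (d v) \<le> c"
      "\<And>v. v \<in> V - R - T \<Longrightarrow> f (d v) \<le> b"
  shows "(\<Sum>v\<in>V. f (d v)) \<le> card R * a + (card V - card R - card T) * b + card T * c"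
proof -
  have finR: "finite R" "finite T" using fin RT by (auto intro: finite_subset)
  have "(\<Sum>v\<in>V. f (d v)) = (\<Sum>v\<in>V - R - T. f (d v)) + (\<Sum>v\<in>R. f (d v)) + (\<Sum>v\<in>T. f (d v))"
  proof -
    have "(\<Sum>v\<in>V. f (d v)) = (\<Sum>v\<in>V - R. f (d v)) + (\<Sum>v\<in>R. f (d v))"
      using fin RT by (intro sum.subset_diff) auto
    moreover have "(\<Sum>v\<in>V - R. f (d v)) = (\<Sum>v\<in>V - R - T. f (d v)) + (\<Sum>v\<in>T. f (d v))"
      using fin RT by (intro sum.subset_diff) auto
    ultimately show ?thesis by simp
  qed
  moreover have "(\<Sum>v\<in>R. f (d v)) \<le> card R * a" using d(1) sum_bounded_above[of R "\<lambda>v. f (d v)" a] by simp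
  moreover have "(\<Sum>v\<in>T. f (d v)) \<le> card T * c" using d(2) sum_bounded_above[of T "\<lambda>v. f (d v)" c] by simp
  moreover have "(\<Sum>v\<in>V - R - T. f (d v)) \<le> card (V - R - T) * b"
    using d(3) sum_bounded_above[of "V - R - T" "\<lambda>v. f (d v)" b] by simp
  moreover have "card (V - R - T) = card V - card R - card T"
  proof -
    have "card (V - R - T) = card (V - R) - card T"
      using RT finR by (intro card_Diff_subset) auto
    then show ?thesis using RT finR by (simp add: card_Diff_subset)
  qed
  ultimately show ?thesis by simp
qed

section \<open>Degrees in graphs without Hamiltonian path\<close>

text \<open>
  A Hamiltonian cycle of the cone over \<open>V\<close> with apex \<open>z\<close> is a Hamiltonian path of \<open>V\<close> closed up
  through \<open>z\<close>. This transfers the degree theorem from cycles to paths.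
\<close>

lemma traceable_if_cone_hamiltonian:
  assumes fin: "finite V" and z: "z \<notin> V" and E: "symp E"
    and cone: "\<And>x y. F x y \<Longrightarrow> x \<noteq> z \<Longrightarrow> y \<noteq> z \<Longrightarrow> E x y"
    and ham: "hamiltonian F (insert z V)"
  shows "traceable E V"
proof -
  obtain xs where xs: "distinct xs" "set xs = insert z V" "successively F (xs @ [hd xs])"
    using ham fin by (auto simp: hamiltonian_iff)
  obtain ys zs where yz: "xs = ys @ z # zs" using xs(2) by (metis insertI1 split_list)
  have "xs \<noteq> []" using yz by simp
  from successively_closed_rotate[OF this xs(3), of "length ys"]
  have "successively F (z # (zs @ ys) @ [z])" by (simp add: yz rotate_append)
  then have "successively F (zs @ ys)"
    by (cases "zs = []"; cases "ys = []") (auto simp: successively_append_iff successively_Cons)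
  moreover have V: "set (zs @ ys) = V" and "distinct (zs @ ys)" using xs(1,2) z by (auto simp: yz)
  moreover have "E x y" if "F x y" "x \<in> set (zs @ ys)" "y \<in> set (zs @ ys)" for x y
    using that z cone unfolding V by blast
  ultimately show ?thesis
    unfolding traceable_def
    by (intro exI[of _ "zs @ ys"] conjI) (auto elim!: successively_mono)
qed

text \<open>
  The degree theorem applied to the cone. Its apex has full degree and therefore is one of the \<open>h\<close>
  unrestricted vertices, so only \<open>h - 1\<close> of these remain in \<open>V\<close>; all other degrees drop by one.
  It is stated for a monotone weight \<open>f\<close> because both \<open>d\<close> and \<open>d (d-1)\<close> are summed below.
  The element \<open>z\<close> outside \<open>V\<close> serves as the apex.
\<close>

lemma nontraceable_degrees:
  fixes f :: "nat \<Rightarrow> nat"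
  assumes fin: "finite V" and E: "symp E" "irreflp E" "\<not> traceable E V" and z: "z \<notin> V"
    and f: "mono f"
  obtains h where "1 \<le> h" "2 * h \<le> card V"
    "(\<Sum>v\<in>V. f (degree E V v))
       \<le> h * f (h - 1) + (card V + 1 - 2 * h) * f (card V - h - 1) + (h - 1) * f (card V - 1)"
proof -
  define F where "F x y \<longleftrightarrow> x \<noteq> y \<and> (x = z \<or> y = z \<or> E x y)" for x y
  define W where "W = insert z V"
  have finW: "finite W" and cW: "card W = card V + 1" using fin z by (auto simp: W_def)
  have "card V \<noteq> 0"
    using E(3) fin unfolding traceable_def by (auto dest: spec[of _ "[]"])
  have "card V \<noteq> 1"
  proof
    assume "card V = 1"
    then obtain v where "V = {v}" by (auto simp: card_1_singleton_iff)
    then show False using E(3) unfolding traceable_def by (auto dest: spec[of _ "[v]"])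
  qed
  have "\<not> hamiltonian F W"
    using traceable_if_cone_hamiltonian[OF fin z E(1), of F] E(3) by (auto simp: F_def W_def)
  moreover have "symp F" "irreflp F" using E(1) by (auto simp: F_def symp_def irreflp_def)
  moreover have "card W \<ge> 3" using cW \<open>card V \<noteq> 0\<close> \<open>card V \<noteq> 1\<close> by simp
  ultimately obtain h R T where h: "1 \<le> h" "2 * h < card W" and RT: "R \<subseteq> W" "T \<subseteq> W" "R \<inter> T = {}"
    "card R = h" "card T = h" and dR: "\<And>v. v \<in> R \<Longrightarrow> degree F W v \<le> h"
    and dM: "\<And>v. v \<in> W - R - T \<Longrightarrow> degree F W v \<le> card W - h - 1"
    using nonhamiltonian_degrees[OF finW] by metis
  have dz: "degree F W z = card V"
  proof -
    have "{u \<in> W. F z u} = V" using z by (auto simp: F_def W_def)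
    then show ?thesis by (simp add: degree_def)
  qed
  have dV: "degree E V v = degree F W v - 1" if "v \<in> V" for v
  proof -
    have "{u \<in> W. F v u} = insert z {u \<in> V. E v u}"
      using that z E(2) by (auto simp: F_def W_def irreflp_def)
    then show ?thesis using fin z by (simp add: degree_def)
  qed
  have "z \<notin> R" using dR[of z] dz h cW by auto
  moreover have "z \<in> T"
  proof (rule ccontr)
    assume "z \<notin> T"
    then have "z \<in> W - R - T" using \<open>z \<notin> R\<close> by (simp add: W_def)
    from dM[OF this] show False using dz h cW by simp
  qed
  ultimately have R: "R \<subseteq> V" "T - {z} \<subseteq> V" "R \<inter> (T - {z}) = {}" "card (T - {z}) = h - 1"
    using RT fin by (auto simp: W_def)
  have "(\<Sum>v\<in>V. f (degree E V v))
     \<le> card R * f (h - 1) + (card V - card R - card (T - {z})) * f (card V - h - 1)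
       + card (T - {z}) * f (card V - 1)"
  proof (rule degree_sum_bound[OF fin R(1-3)])
    show "f (degree E V v) \<le> f (h - 1)" if "v \<in> R" for v
      using dR[OF that] dV[of v] that R(1) by (intro monoD[OF f]) auto
    show "f (degree E V v) \<le> f (card V - 1)" if "v \<in> T - {z}" for v
      using degree_le[OF fin E(2), of v] that R(2) by (intro monoD[OF f]) auto
    show "f (degree E V v) \<le> f (card V - h - 1)" if "v \<in> V - R - (T - {z})" for v
      using dM[of v] dV[of v] that z cW by (intro monoD[OF f]) (auto simp: W_def)
  qed
  moreover have "card V - card R - card (T - {z}) = card V + 1 - 2 * h"
    using RT(4) R(4) h by simp
  ultimately show ?thesis using that[of h] h cW RT(4) R(4) by simp
qed

text \<open>
  Ore's bound for the number of edges. With \<open>h = g + 1\<close> and \<open>|V| = 2h + t\<close>, the bound from the degree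
  theorem stays below the right side by \<open>g (g - 1 + 2t)\<close>.
\<close>

lemma nontraceable_degree_sum:
  assumes fin: "finite V" and E: "symp E" "irreflp E" "\<not> traceable E V" and z: "z \<notin> V"
  shows "(\<Sum>v\<in>V. degree E V v) \<le> (card V - 1) * (card V - 2)"
proof -
  obtain h where h: "1 \<le> h" "2 * h \<le> card V"
    and *: "(\<Sum>v\<in>V. degree E V v)
       \<le> h * (h - 1) + (card V + 1 - 2 * h) * (card V - h - 1) + (h - 1) * (card V - 1)"
    using nontraceable_degrees[OF fin E z, of "\<lambda>d. d"] by (auto simp: mono_def)
  obtain g where g: "h = Suc g" using h by (cases h) auto
  obtain t where t: "card V = 2 * h + t" using h le_Suc_ex by blast
  have "(\<Sum>v\<in>V. degree E V v)
          \<le> Suc g * g + Suc t * (g + t) + g * (2 * g + t + 1)"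
    using * by (simp add: g t)
  also have "\<dots> \<le> (2 * g + t + 1) * (2 * g + t)"
    by (cases g) (auto simp: algebra_simps)
  finally show ?thesis by (simp add: g t)
qed

text \<open>
  The sum counts paths with three vertices by their middle vertex. It is needed for the one length
  at which removing two vertices would leave a single inner vertex between ends that may both
  dominate the rest, where the bound for paths is false.
\<close>

lemma nontraceable_degree_square_sum:
  assumes fin: "finite V" and E: "symp E" "irreflp E" "\<not> traceable E V" and z: "z \<notin> V"
  shows "(\<Sum>v\<in>V. degree E V v * (degree E V v - 1)) \<le> (card V - 1) * (card V - 2) * (card V - 3)"
proof -
  obtain h where h: "1 \<le> h" "2 * h \<le> card V"
    and *: "(\<Sum>v\<in>V. degree E V v * (degree E V v - 1))
       \<le> h * ((h - 1) * (h - 1 - 1)) + (card V + 1 - 2 * h) * ((card V - h - 1) * (card V - h - 1 - 1))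
         + (h - 1) * ((card V - 1) * (card V - 1 - 1))"
    using nontraceable_degrees[OF fin E z, of "\<lambda>d. d * (d - 1)"]
    by (auto simp: mono_def intro!: mult_le_mono diff_le_mono)
  obtain t where t: "card V = 2 * h + t" using h le_Suc_ex by blast
  consider "h = 1" | g where "h = Suc (Suc g)"
    using h by (metis One_nat_def Suc_le_D not0_implies_Suc)
  then show ?thesis
  proof cases
    case 1
    then show ?thesis using * by (simp add: t) (simp add: algebra_simps)
  next
    case 2
    have "(\<Sum>v\<in>V. degree E V v * (degree E V v - 1))
          \<le> (g + 2) * ((g + 1) * g) + (t + 1) * ((g + 1 + t) * (g + t))
              + (g + 1) * ((2 * g + t + 3) * (2 * g + t + 2))"
    proof -
      have "h - 1 = g + 1" "h - 1 - 1 = g" "card V + 1 - 2 * h = t + 1" "card V - h - 1 = g + 1 + t"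
        "card V - h - 1 - 1 = g + t" "card V - 1 = 2 * g + t + 3" "card V - 1 - 1 = 2 * g + t + 2"
        "h = g + 2"
        using t 2 by simp_all
      then show ?thesis using * by simp
    qed
    also have "\<dots> \<le> (2 * g + t + 3) * (2 * g + t + 2) * (2 * g + t + 1)"
      by (simp add: algebra_simps)
    also have "\<dots> = (card V - 1) * (card V - 2) * (card V - 3)"
    proof -
      have "card V - 1 = 2 * g + t + 3" "card V - 2 = 2 * g + t + 2" "card V - 3 = 2 * g + t + 1"
        using t 2 by simp_all
      then show ?thesis by simp
    qed
    finally show ?thesis .
  qed
qed

section \<open>Paths that cannot use all vertices\<close>

definition dominates :: "('a \<Rightarrow> 'a \<Rightarrow> bool) \<Rightarrow> 'a \<Rightarrow> 'a set \<Rightarrow> bool" where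
  "dominates E v V \<longleftrightarrow> (\<forall>x\<in>V. E v x)"

lemma finite_inner_paths: "finite V \<Longrightarrow> finite (inner_paths E V s a b)"
  by (rule finite_subset[OF _ finite_lists_length_eq[of V s]]) (auto simp: inner_paths_def)

lemma inner_paths_0: "inner_paths E V 0 a b = (if E a b then {[]} else {})"
  by (auto simp: inner_paths_def)

lemma inner_paths_Suc:
  "inner_paths E V (Suc s) a b = (\<Union>c\<in>{c \<in> V. E a c}. (#) c ` inner_paths E (V - {c}) s c b)"
proof (intro equalityI subsetI)
  fix xs assume xs: "xs \<in> inner_paths E V (Suc s) a b"
  then obtain c ys where cys: "xs = c # ys" by (cases xs) (auto simp: inner_paths_def)
  then have "c \<in> {c \<in> V. E a c}" "ys \<in> inner_paths E (V - {c}) s c b"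
    using xs by (simp_all add: inner_paths_def subset_Diff_insert)
  then show "xs \<in> (\<Union>c\<in>{c \<in> V. E a c}. (#) c ` inner_paths E (V - {c}) s c b)"
    unfolding cys by blast
next
  fix xs assume "xs \<in> (\<Union>c\<in>{c \<in> V. E a c}. (#) c ` inner_paths E (V - {c}) s c b)"
  then obtain c ys where "c \<in> V" "E a c" "xs = c # ys" "ys \<in> inner_paths E (V - {c}) s c b"
    by blast
  then show "xs \<in> inner_paths E V (Suc s) a b"
    by (simp add: inner_paths_def subset_Diff_insert)
qed

lemma card_inner_paths_Suc:
  assumes "finite V"
  shows "card (inner_paths E V (Suc s) a b)
           = (\<Sum>c | c \<in> V \<and> E a c. card (inner_paths E (V - {c}) s c b))"
proof -
  have "card (inner_paths E V (Suc s) a b)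
     = (\<Sum>c\<in>{c \<in> V. E a c}. card ((#) c ` inner_paths E (V - {c}) s c b))"
    unfolding inner_paths_Suc using assms
    by (intro card_UN_disjoint) (auto intro: finite_inner_paths)
  then show ?thesis by (simp add: card_image)
qed

lemma card_inner_paths_1:
  assumes "finite V"
  shows "card (inner_paths E V 1 a b) = card {c \<in> V. E a c \<and> E c b}"
proof -
  have "card (inner_paths E V 1 a b) = (\<Sum>c | c \<in> V \<and> E a c. if E c b then 1 else 0)"
    using card_inner_paths_Suc[OF assms, of E 0] by (simp add: inner_paths_0 if_distrib cong: if_cong)
  also have "\<dots> = card ({c \<in> V. E a c} \<inter> {c. E c b})"
    using assms by (subst sum.If_cases) auto
  also have "{c \<in> V. E a c} \<inter> {c. E c b} = {c \<in> V. E a c \<and> E c b}" by auto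
  finally show ?thesis .
qed

lemma card_inner_paths_commute:
  assumes "symp E"
  shows "card (inner_paths E V s a b) = card (inner_paths E V s b a)"
proof -
  have *: "rev ` inner_paths E V s a b \<subseteq> inner_paths E V s b a" for a b
  proof
    fix ys assume "ys \<in> rev ` inner_paths E V s a b"
    then obtain xs where xs: "ys = rev xs" "xs \<in> inner_paths E V s a b" by auto
    have "successively (\<lambda>x y. E y x) (rev (a # xs @ [b]))"
      using xs(2) by (simp only: successively_rev inner_paths_def mem_Collect_eq)
    then have "successively E (rev (a # xs @ [b]))"
      by (rule successively_mono) (use assms in \<open>auto simp: symp_def\<close>)
    then show "ys \<in> inner_paths E V s b a" using xs by (auto simp: inner_paths_def)
  qed
  have "inner_paths E V s b a = rev ` inner_paths E V s a b"
  proof (intro equalityI subsetI)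
    fix xs assume "xs \<in> inner_paths E V s b a"
    then have "rev xs \<in> inner_paths E V s a b" using *[of b a] by blast
    then show "xs \<in> rev ` inner_paths E V s a b" by (rule rev_image_eqI) simp
  qed (use *[of a b] in blast)
  then show ?thesis by (simp add: card_image)
qed

lemma inner_paths_empty_commute:
  assumes "symp E" "finite V"
  shows "inner_paths E V s a b = {} \<longleftrightarrow> inner_paths E V s b a = {}"
  using card_inner_paths_commute[OF assms(1), of V s a b] finite_inner_paths[OF assms(2)]
  by (metis card_0_eq)

text \<open>
  The property that is inherited when the first inner vertex is split off.
\<close>

lemma spanning_inner_paths_peel:
  assumes "finite V" "c \<in> V" "E a c" "inner_paths E V (card V) a b = {}"
  shows "inner_paths E (V - {c}) (card (V - {c})) c b = {}"
proof -
  have "card V = Suc (card (V - {c}))" using assms(1,2) by (metis card_Suc_Diff1)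
  then have "(#) c ` inner_paths E (V - {c}) (card (V - {c})) c b \<subseteq> inner_paths E V (card V) a b"
    using assms(2,3) inner_paths_Suc[of E V "card (V - {c})" a b] by auto
  then show ?thesis using assms(4) by auto
qed

lemma card_inner_paths_2_le:
  assumes fin: "finite V" and irr: "irreflp E"
  shows "card (inner_paths E V 2 a b) \<le> (\<Sum>c | c \<in> V \<and> E a c. degree E V c)"
proof -
  have "card (inner_paths E V 2 a b)
     = (\<Sum>c | c \<in> V \<and> E a c. card {x \<in> V - {c}. E c x \<and> E x b})"
    using card_inner_paths_Suc[OF fin, of E 1] fin
    by (simp add: numeral_2_eq_2 card_inner_paths_1[simplified])
  also have "\<dots> \<le> (\<Sum>c | c \<in> V \<and> E a c. degree E V c)"
    unfolding degree_def using fin by (intro sum_mono card_mono) auto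
  finally show ?thesis .
qed

lemma card_inner_paths_3_le:
  assumes fin: "finite V" and E: "symp E"
  shows "card (inner_paths E V 3 a b) \<le> (\<Sum>v\<in>V. degree E V v * (degree E V v - 1))"
proof -
  define N where "N v = {x \<in> V. E v x}" for v
  have finN: "finite (N v)" for v using fin by (simp add: N_def)
  let ?A = "\<lambda>v. (\<lambda>(x, y). [x, v, y]) ` Sigma (N v) (\<lambda>x. N v - {x})"
  have "inner_paths E V 3 a b \<subseteq> (\<Union>v\<in>V. ?A v)"
  proof
    fix xs assume xs: "xs \<in> inner_paths E V 3 a b"
    then obtain x v y where xvy: "xs = [x, v, y]"
      by (auto simp: inner_paths_def numeral_3_eq_3 length_Suc_conv)
    have "v \<in> V" "x \<in> N v" "y \<in> N v - {x}"
      using xs E xvy by (auto simp: inner_paths_def N_def symp_def)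
    then have "v \<in> V" "xs \<in> ?A v"
      by (auto simp: xvy intro!: image_eqI[of _ _ "(x, y)"])
    then show "xs \<in> (\<Union>v\<in>V. ?A v)" by (rule UN_I)
  qed
  then have "card (inner_paths E V 3 a b) \<le> card (\<Union>v\<in>V. ?A v)"
    using fin finN by (intro card_mono) auto
  also have "\<dots> \<le> (\<Sum>v\<in>V. card (?A v))" using fin by (rule card_UN_le)
  also have "\<dots> \<le> (\<Sum>v\<in>V. card (Sigma (N v) (\<lambda>x. N v - {x})))"
    using finN by (intro sum_mono card_image_le) auto
  also have "\<dots> = (\<Sum>v\<in>V. degree E V v * (degree E V v - 1))"
    using finN by (simp add: degree_def N_def[symmetric])
  finally show ?thesis .
qed

lemma card_nondominated:
  assumes "finite V" "\<not> dominates E a V"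
  shows "card {c \<in> V. E a c} \<le> card V - 1"
proof -
  have "{c \<in> V. E a c} \<subset> V" using assms(2) by (auto simp: dominates_def)
  from psubset_card_mono[OF assms(1) this] show ?thesis by simp
qed

text \<open>
  The case of two inner vertices in which splitting off the first one fails, because some neighbour
  \<open>c\<close> of \<open>a\<close> may see two dominating ends afterwards. If \<open>V\<close> has no Hamiltonian path, its number of
  edges is small enough. Otherwise neither end of a Hamiltonian path of \<open>V\<close> is adjacent to \<open>a\<close>, since
  \<open>b\<close> is adjacent to everything except possibly \<open>c\<close>; so \<open>a\<close> has at most \<open>|V| - 2\<close> neighbours.
\<close>

lemma card_inner_paths_2_nondominating:
  assumes E: "symp E" "irreflp E" and fin: "finite V" and a: "a \<notin> V"
    and nospan: "inner_paths E V (card V) a b = {}" and nd: "\<not> dominates E a V"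
    and c: "c \<in> V" "E a c" "dominates E b (V - {c})"
  shows "card (inner_paths E V 2 a b) \<le> (card V - 1) * (card V - 2)"
proof (cases "traceable E V")
  case False
  have "card (inner_paths E V 2 a b) \<le> (\<Sum>c | c \<in> V \<and> E a c. degree E V c)"
    by (rule card_inner_paths_2_le[OF fin E(2)])
  also have "\<dots> \<le> (\<Sum>c\<in>V. degree E V c)" using fin by (intro sum_mono2) auto
  also have "\<dots> \<le> (card V - 1) * (card V - 2)"
    by (rule nontraceable_degree_sum[OF fin E False a])
  finally show ?thesis .
next
  case True
  obtain x where x: "x \<in> V" "\<not> E a x" using nd by (auto simp: dominates_def)
  obtain p where p: "distinct p" "set p = V" "successively E p"
    using True by (auto simp: traceable_def)
  have ne: "p \<noteq> []" using p c by auto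
  have len: "length p = card V" using p distinct_card by metis
  have two: "hd p \<noteq> last p"
  proof
    assume "hd p = last p"
    then have "p = [hd p]" using p(1) ne by (cases p) (auto split: if_splits)
    then have "V = {hd p}" using p(2) by (metis empty_set list.simps(15))
    then show False using x c by auto
  qed
  have "successively E (rev p)"
    using p(3) E(1) by (auto simp: symp_def elim: successively_mono)
  then have "rev p \<in> inner_paths E V (card V) a b" if "E a (last p)" "E (hd p) b"
    using p len ne that
    by (auto simp: inner_paths_def successively_append_iff successively_Cons hd_rev last_rev)
  then have 1: "\<not> (E a (last p) \<and> E (hd p) b)" using nospan by auto
  have "p \<in> inner_paths E V (card V) a b" if "E a (hd p)" "E (last p) b"
    using p len ne that
    by (auto simp: inner_paths_def successively_append_iff successively_Cons)
  then have 2: "\<not> (E a (hd p) \<and> E (last p) b)" using nospan by auto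
  have mem: "hd p \<in> V" "last p \<in> V" using p(2) ne by auto
  have b: "E v b" if "v \<in> V" "v \<noteq> c" for v
    using c(3) that E(1) by (auto simp: dominates_def symp_def)
  have "\<not> E a (hd p)" "\<not> E a (last p)" using 1 2 b mem two c(2) by metis+
  then have "{c \<in> V. E a c} \<subseteq> V - {hd p, last p}" by auto
  then have "card {c \<in> V. E a c} \<le> card (V - {hd p, last p})" using fin by (intro card_mono) auto
  also have "\<dots> = card V - 2" using mem two fin by (simp add: card_Diff_subset)
  finally have cA: "card {c \<in> V. E a c} \<le> card V - 2" .
  have "card (inner_paths E V 2 a b) \<le> (\<Sum>c | c \<in> V \<and> E a c. degree E V c)"
    by (rule card_inner_paths_2_le[OF fin E(2)])
  also have "\<dots> \<le> card {c \<in> V. E a c} * (card V - 1)"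
    using sum_bounded_above[of "{c \<in> V. E a c}" "degree E V" "card V - 1"] degree_le[OF fin E(2)]
    by simp
  also have "\<dots> \<le> (card V - 2) * (card V - 1)" using cA by (rule mult_le_mono1)
  finally show ?thesis by (simp add: mult.commute)
qed

text \<open>
  The bound is what one gets when one vertex of \<open>V\<close> is never visited. It fails for one inner vertex
  between two ends that dominate \<open>V\<close>: there are \<open>|V|\<close> such paths, even if \<open>V\<close> is edgeless. This is why
  that case is excluded and why the induction has to watch out for it: it removes one vertex next to
  an end that misses part of \<open>V\<close>, and two vertices at once if both ends dominate \<open>V\<close>.
\<close>

theorem card_inner_paths_le:
  assumes E: "symp E" "irreflp E"
  shows "finite V \<Longrightarrow> a \<notin> V \<Longrightarrow> b \<notin> V \<Longrightarrow> inner_paths E V (card V) a b = {} \<Longrightarrow> 1 \<le> s \<Longrightarrow>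
    2 \<le> s \<or> \<not> dominates E a V \<or> \<not> dominates E b V \<Longrightarrow>
    card (inner_paths E V s a b) \<le> falling (card V - 1) s"
proof (induction s arbitrary: V a b rule: less_induct)
  case (less s)
  note fin = less.prems(1) and nospan = less.prems(4)
  have step: "card (inner_paths E V s a b) \<le> falling (card V - 1) s"
    if a: "a \<notin> V" and b: "b \<notin> V" and nospan: "inner_paths E V (card V) a b = {}"
      and s: "2 \<le> s" and nd: "\<not> dominates E a V" for a b
  proof (cases "s = 2 \<and> (\<exists>c\<in>V. E a c \<and> dominates E b (V - {c}))")
    case True
    then show ?thesis
      using card_inner_paths_2_nondominating[OF E fin a nospan nd] by (auto simp: numeral_2_eq_2)
  next
    case False
    obtain t where t: "s = Suc t" "1 \<le> t" using s by (cases s) auto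
    have "card (inner_paths E (V - {c}) t c b) \<le> falling (card V - 2) t"
      if c: "c \<in> V" "E a c" for c
    proof -
      have "card (inner_paths E (V - {c}) t c b) \<le> falling (card (V - {c}) - 1) t"
      proof (rule less.IH)
        show "inner_paths E (V - {c}) (card (V - {c})) c b = {}"
          using spanning_inner_paths_peel[OF fin c nospan] .
        show "2 \<le> t \<or> \<not> dominates E c (V - {c}) \<or> \<not> dominates E b (V - {c})"
          using False t c by auto
      qed (use t fin b in auto)
      then show ?thesis using c fin by (simp add: numeral_2_eq_2)
    qed
    then have "card (inner_paths E V s a b) \<le> card {c \<in> V. E a c} * falling (card V - 2) t"
      unfolding t(1) card_inner_paths_Suc[OF fin]
      using sum_bounded_above[of "{c \<in> V. E a c}" _ "falling (card V - 2) t"] by simp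
    also have "\<dots> \<le> (card V - 1) * falling (card V - 2) t"
      by (intro mult_le_mono1 card_nondominated fin nd)
    finally show ?thesis by (simp add: t numeral_2_eq_2)
  qed
  show ?case
  proof (cases "s = 1")
    case True
    have "\<not> dominates E a V \<or> \<not> dominates E b V" using less.prems(6) True by simp
    then have "{c \<in> V. E a c \<and> E c b} \<subset> V" using E(1) by (auto simp: dominates_def symp_def)
    then have "card {c \<in> V. E a c \<and> E c b} < card V" using fin by (rule psubset_card_mono[rotated])
    then show ?thesis using True card_inner_paths_1[OF fin, of E a b] by simp
  next
    case False
    then have s: "2 \<le> s" using less.prems(5) by simp
    consider "\<not> dominates E a V" | "\<not> dominates E b V" | "dominates E a V" "dominates E b V" by blast
    then show ?thesis
    proof cases
      case 1
      then show ?thesis using step[OF less.prems(2,3) nospan s] by simp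
    next
      case 2
      have "inner_paths E V (card V) b a = {}"
        using nospan inner_paths_empty_commute[OF E(1) fin] by blast
      from step[OF less.prems(3,2) this s 2] show ?thesis
        using card_inner_paths_commute[OF E(1), of V s a b] by simp
    next
      case 3
      show ?thesis
      proof (cases "V = {}")
        case True
        then have "inner_paths E V s a b = {}" using s by (auto simp: inner_paths_def)
        then show ?thesis by simp
      next
        case nonempty: False
        have nt: "\<not> traceable E V"
        proof
          assume "traceable E V"
          then obtain p where p: "distinct p" "set p = V" "successively E p" by (auto simp: traceable_def)
          then have "p \<noteq> []" "length p = card V" using nonempty distinct_card by fastforce+
          moreover have "E (last p) b" "E a (hd p)"
            using 3 p(2) calculation E(1) by (auto simp: dominates_def symp_def)
          ultimately have "p \<in> inner_paths E V (card V) a b"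
            using p by (auto simp: inner_paths_def successively_append_iff successively_Cons)
          then show False using nospan by auto
        qed
        note sum1 = nontraceable_degree_sum[OF fin E nt less.prems(2)]
        have V: "{c. c \<in> V \<and> E a c} = V" using 3 by (auto simp: dominates_def)
        consider "s = 2" | "s = 3" | t where "s = Suc (Suc t)" "2 \<le> t"
          using s by (metis One_nat_def Suc_1 Suc_leD le_antisym not_less_eq_eq numeral_3_eq_3 old.nat.exhaust)
        then show ?thesis
        proof cases
          case 1
          then show ?thesis using card_inner_paths_2_le[OF fin E(2), of a b] sum1
            by (simp add: V numeral_2_eq_2)
        next
          case 2
          then show ?thesis
            using card_inner_paths_3_le[OF fin E(1), of a b]
              nontraceable_degree_square_sum[OF fin E nt less.prems(2)]
            by (simp add: numeral_3_eq_3 numeral_2_eq_2 mult.assoc)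
        next
          case (3 t)
          \<comment> \<open>Summing over the first two inner vertices turns the count into one over the edges of \<open>V\<close>.\<close>
          have *: "card (inner_paths E (V - {c}) (Suc t) c b) \<le> degree E V c * falling (card V - 3) t"
            if c: "c \<in> V" "E a c" for c
          proof -
            let ?W = "V - {c}"
            have W: "inner_paths E ?W (card ?W) c b = {}"
              using spanning_inner_paths_peel[OF fin c nospan] .
            have "card (inner_paths E (?W - {d}) t d b) \<le> falling (card V - 3) t"
              if d: "d \<in> ?W" "E c d" for d
            proof -
              have "card (inner_paths E (?W - {d}) t d b) \<le> falling (card (?W - {d}) - 1) t"
                using 3 fin less.prems(3) spanning_inner_paths_peel[OF _ d W]
                by (intro less.IH) auto
              then show ?thesis using c d fin by (simp add: numeral_3_eq_3)
            qed
            then have "card (inner_paths E ?W (Suc t) c b) \<le> card {d \<in> ?W. E c d} * falling (card V - 3) t"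
              using card_inner_paths_Suc[of ?W E t c b] fin
                sum_bounded_above[of "{d \<in> ?W. E c d}" "\<lambda>d. card (inner_paths E (?W - {d}) t d b)" "falling (card V - 3) t"]
              by simp
            also have "{d \<in> ?W. E c d} = {d \<in> V. E c d}" using E(2) by (auto simp: irreflp_def)
            finally show ?thesis by (simp add: degree_def)
          qed
          have "card (inner_paths E V s a b) = (\<Sum>c\<in>V. card (inner_paths E (V - {c}) (Suc t) c b))"
            unfolding 3 card_inner_paths_Suc[OF fin, of E "Suc t"] by (simp add: V)
          also have "\<dots> \<le> (\<Sum>c\<in>V. degree E V c * falling (card V - 3) t)"
            using * V by (intro sum_mono) blast
          also have "\<dots> = (\<Sum>c\<in>V. degree E V c) * falling (card V - 3) t"
            by (simp add: sum_distrib_right)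
          also have "\<dots> \<le> (card V - 1) * (card V - 2) * falling (card V - 3) t"
            using sum1 by (rule mult_le_mono1)
          finally show ?thesis using 3 by (simp add: numeral_3_eq_3 numeral_2_eq_2 mult.assoc)
        qed
      qed
    qed
  qed
qed

section \<open>Closed sequences in graphs without Hamiltonian cycle\<close>

lemma falling_pos: "s \<le> m \<Longrightarrow> 0 < falling m s"
  by (induction s arbitrary: m) auto

lemma falling_mult_fact: "s \<le> m \<Longrightarrow> falling m s * fact (m - s) = fact m"
proof (induction s arbitrary: m)
  case (Suc s)
  then obtain l where "m = Suc l" by (cases m) auto
  then show ?case using Suc.IH[of l] Suc.prems by (simp add: mult.assoc del: mult_Suc)
qed simp

lemma card_distinct_lists:
  assumes "finite V" and "k \<le> card V"
  shows "card {xs. length xs = k \<and> distinct xs \<and> set xs \<subseteq> V} = falling (card V) k"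
proof -
  have "card {xs. length xs = k \<and> distinct xs \<and> set xs \<subseteq> V} * fact (card V - k)
          = (fact (card V) :: nat)"
    using card_lists_distinct_length_eq[OF assms] assms(2)
      fact_div_fact[of "card V - k" "card V"] fact_dvd[of "card V - k" "card V", where 'a = nat]
    by (metis One_nat_def Suc_eq_plus1 diff_le_self dvd_div_mult_self)
  also have "\<dots> = falling (card V) k * fact (card V - k)"
    using falling_mult_fact[OF assms(2)] by simp
  finally show ?thesis by simp
qed

lemma closed_seqs_Suc:
  "closed_seqs E V (Suc s) = (\<Union>u\<in>V. (#) u ` inner_paths E (V - {u}) s u u)"
proof (intro equalityI subsetI)
  fix xs assume xs: "xs \<in> closed_seqs E V (Suc s)"
  then obtain c ys where cys: "xs = c # ys" by (cases xs) (auto simp: closed_seqs_def)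
  then have "c \<in> V" "ys \<in> inner_paths E (V - {c}) s c c"
    using xs by (simp_all add: inner_paths_def closed_seqs_def subset_Diff_insert)
  then show "xs \<in> (\<Union>u\<in>V. (#) u ` inner_paths E (V - {u}) s u u)"
    unfolding cys by blast
next
  fix xs assume "xs \<in> (\<Union>u\<in>V. (#) u ` inner_paths E (V - {u}) s u u)"
  then obtain c ys where "c \<in> V" "xs = c # ys" "ys \<in> inner_paths E (V - {c}) s c c"
    by blast
  then show "xs \<in> closed_seqs E V (Suc s)"
    by (simp add: inner_paths_def closed_seqs_def subset_Diff_insert)
qed

lemma card_closed_seqs_Suc:
  assumes "finite V"
  shows "card (closed_seqs E V (Suc s)) = (\<Sum>u\<in>V. card (inner_paths E (V - {u}) s u u))"
proof -
  have "card (closed_seqs E V (Suc s)) = (\<Sum>u\<in>V. card ((#) u ` inner_paths E (V - {u}) s u u))"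
    unfolding closed_seqs_Suc using assms
    by (intro card_UN_disjoint) (auto intro: finite_inner_paths)
  then show ?thesis by (simp add: card_image)
qed

lemma nonhamiltonian_inner_paths:
  assumes "finite V" "\<not> hamiltonian E V" "u \<in> V"
  shows "inner_paths E (V - {u}) (card (V - {u})) u u = {}"
proof -
  have "card V = Suc (card (V - {u}))" using assms(1,3) by (metis card_Suc_Diff1)
  then have "closed_seqs E V (Suc (card (V - {u}))) = {}"
    using assms(2) by (simp add: hamiltonian_def)
  then have "(#) u ` inner_paths E (V - {u}) (card (V - {u})) u u = {}"
    unfolding closed_seqs_Suc using assms(3) by blast
  then show ?thesis by simp
qed

text \<open>
  Plain use of the path bound in \<open>V - {u}\<close> gives the factor \<open>n - 2\<close>; if \<open>u\<close> misses a vertex, then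
  splitting off the first neighbour first gives the factor \<open>deg u\<close>. In the second case the end \<open>u\<close>
  still misses a vertex after the split, so a single remaining inner vertex does no harm.
\<close>

lemma card_closed_seqs_at_vertex:
  assumes E: "symp E" "irreflp E" and fin: "finite V" and nh: "\<not> hamiltonian E V"
    and u: "u \<in> V" and t: "1 \<le> t"
  shows "card (inner_paths E (V - {u}) (Suc t) u u)
           \<le> min (degree E V u) (card V - 2) * falling (card V - 3) t"
proof -
  let ?W = "V - {u}"
  have cW: "card ?W = card V - 1" using u fin by simp
  have finW: "finite ?W" using fin by simp
  have nospan: "inner_paths E ?W (card ?W) u u = {}"
    using nonhamiltonian_inner_paths[OF fin nh u] .
  have nb: "{c \<in> ?W. E u c} = {c \<in> V. E u c}" using E(2) by (auto simp: irreflp_def)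
  show ?thesis
  proof (cases "dominates E u ?W")
    case True
    then have "{c \<in> V. E u c} = ?W" using nb by (auto simp: dominates_def)
    then have "degree E V u = card V - 1" using cW by (simp add: degree_def)
    moreover have "card (inner_paths E ?W (Suc t) u u) \<le> falling (card ?W - 1) (Suc t)"
      using t by (intro card_inner_paths_le[OF E finW _ _ nospan]) auto
    moreover have "falling (card ?W - 1) (Suc t) = (card V - 2) * falling (card V - 3) t"
      using cW by (simp add: numeral_2_eq_2 numeral_3_eq_3)
    ultimately show ?thesis by simp
  next
    case False
    have "card (inner_paths E (?W - {c}) t c u) \<le> falling (card V - 3) t"
      if c: "c \<in> ?W" "E u c" for c
    proof -
      have "inner_paths E (?W - {c}) (card (?W - {c})) c u = {}"
        using spanning_inner_paths_peel[OF finW c nospan] .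
      moreover have "\<not> dominates E u (?W - {c})" using False c(2) by (auto simp: dominates_def)
      ultimately have "card (inner_paths E (?W - {c}) t c u) \<le> falling (card (?W - {c}) - 1) t"
        using card_inner_paths_le[OF E, of "?W - {c}" c u t] t fin by simp
      then show ?thesis using c u fin by (simp add: numeral_3_eq_3)
    qed
    then have "card (inner_paths E ?W (Suc t) u u) \<le> card {c \<in> ?W. E u c} * falling (card V - 3) t"
      using card_inner_paths_Suc[OF finW, of E t u u]
        sum_bounded_above[of "{c \<in> ?W. E u c}" "\<lambda>c. card (inner_paths E (?W - {c}) t c u)"
          "falling (card V - 3) t"]
      by simp
    then have "card (inner_paths E ?W (Suc t) u u) \<le> degree E V u * falling (card V - 3) t"
      unfolding nb degree_def .
    moreover have "degree E V u \<le> card V - 2"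
      using card_nondominated[OF finW False] cW unfolding nb degree_def by (simp add: numeral_2_eq_2)
    ultimately show ?thesis by simp
  qed
qed

lemma card_closed_seqs_le_degrees:
  assumes "symp E" "irreflp E" "finite V" "\<not> hamiltonian E V" "3 \<le> k"
  shows "card (closed_seqs E V k)
           \<le> (\<Sum>v\<in>V. min (degree E V v) (card V - 2)) * falling (card V - 3) (k - 2)"
proof -
  obtain t where t: "k = Suc (Suc t)" "1 \<le> t"
    using assms(5) by (metis One_nat_def Suc_le_D Suc_le_mono numeral_3_eq_3)
  have "card (closed_seqs E V k) = (\<Sum>u\<in>V. card (inner_paths E (V - {u}) (Suc t) u u))"
    unfolding t(1) by (rule card_closed_seqs_Suc[OF assms(3)])
  also have "\<dots> \<le> (\<Sum>v\<in>V. min (degree E V v) (card V - 2) * falling (card V - 3) t)"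
    by (intro sum_mono card_closed_seqs_at_vertex assms t)
  finally show ?thesis using t by (simp add: sum_distrib_right)
qed

text \<open>
  A vertex on a cycle has two distinct neighbours on it.
\<close>

lemma closed_seqs_avoid_leaf:
  assumes E: "symp E" and fin: "finite V" and x: "degree E V x \<le> 1" and k: "3 \<le> k"
  shows "closed_seqs E V k \<subseteq> {xs. length xs = k \<and> distinct xs \<and> set xs \<subseteq> V - {x}}"
proof
  fix xs assume xs: "xs \<in> closed_seqs E V k"
  have "x \<notin> set xs"
  proof
    assume "x \<in> set xs"
    then obtain as bs where split: "xs = as @ x # bs" by (meson split_list)
    define ys where "ys = bs @ as"
    have "xs \<noteq> []" using split by simp
    from successively_closed_rotate[OF this, of E "length as"]
    have cl: "successively E (x # ys @ [x])"
      using xs by (simp add: split rotate_append closed_seqs_def ys_def)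
    have ys: "distinct ys" "set ys \<subseteq> V" "length ys \<ge> 2"
      using xs k by (auto simp: ys_def closed_seqs_def split)
    then have ne: "ys \<noteq> []" by auto
    have "hd ys \<noteq> last ys"
    proof
      assume "hd ys = last ys"
      then have "ys = [hd ys]" using ys(1) ne by (cases ys) (auto split: if_splits)
      then show False using ys(3) by (metis One_nat_def Suc_1 length_Cons list.size(3) not_less_eq_eq le_refl)
    qed
    moreover have "E x (hd ys)" "E x (last ys)"
      using cl ne E by (auto simp: successively_append_iff successively_Cons symp_def)
    moreover have "hd ys \<in> V" "last ys \<in> V" using ys(2) ne by auto
    ultimately have "{hd ys, last ys} \<subseteq> {u \<in> V. E x u}" "card {hd ys, last ys} = 2" by auto
    then have "2 \<le> degree E V x"
      unfolding degree_def using card_mono[of "{u \<in> V. E x u}" "{hd ys, last ys}"] fin by simp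
    then show False using x by simp
  qed
  then show "xs \<in> {xs. length xs = k \<and> distinct xs \<and> set xs \<subseteq> V - {x}}"
    using xs by (auto simp: closed_seqs_def)
qed

lemma nonhamiltonian_leaf:
  assumes E: "symp E" and fin: "finite V" and x: "x \<in> V" "degree E V x \<le> 1" and n: "3 \<le> card V"
  shows "\<not> hamiltonian E V"
proof
  assume "hamiltonian E V"
  then obtain xs where "xs \<in> closed_seqs E V (card V)" by (auto simp: hamiltonian_def)
  then have "length xs = card V" "distinct xs" "set xs \<subseteq> V - {x}"
    using closed_seqs_avoid_leaf[OF E fin x(2) n] by auto
  then have "card V \<le> card (V - {x})" using fin by (metis card_mono distinct_card finite_Diff)
  then show False using fin x n by simp
qed

lemma card_closed_seqs_leaf_le:
  assumes E: "symp E" and fin: "finite V" and x: "x \<in> V" "degree E V x \<le> 1"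
    and k: "3 \<le> k" "k \<le> card V - 1"
  shows "card (closed_seqs E V k) \<le> falling (card V - 1) k"
proof -
  let ?D = "{xs. length xs = k \<and> distinct xs \<and> set xs \<subseteq> V - {x}}"
  have "finite ?D" by (rule finite_subset[OF _ finite_lists_length_eq[of "V - {x}" k]]) (auto simp: fin)
  then have "card (closed_seqs E V k) \<le> card ?D"
    by (rule card_mono) (rule closed_seqs_avoid_leaf[OF E fin x(2) k(1)])
  also have "\<dots> = falling (card V - 1) k"
    using card_distinct_lists[of "V - {x}" k] fin x k by simp
  finally show ?thesis .
qed

text \<open>
  Equality forces every sequence in \<open>V - {x}\<close> to be closed. Two nonadjacent vertices \<open>p\<close>, \<open>q\<close> could be
  put at the beginning of such a sequence, because \<open>2 \<le> k \<le> n - 1\<close>.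
\<close>

lemma card_closed_seqs_leaf_eq_iff:
  assumes E: "symp E" and fin: "finite V" and x: "x \<in> V" "degree E V x \<le> 1"
    and k: "3 \<le> k" "k \<le> card V - 1"
  shows "card (closed_seqs E V k) = falling (card V - 1) k
           \<longleftrightarrow> (\<forall>u\<in>V - {x}. \<forall>v\<in>V - {x}. u \<noteq> v \<longrightarrow> E u v)"
proof -
  let ?D = "{xs. length xs = k \<and> distinct xs \<and> set xs \<subseteq> V - {x}}"
  have finD: "finite ?D" by (rule finite_subset[OF _ finite_lists_length_eq[of "V - {x}" k]]) (auto simp: fin)
  have sub: "closed_seqs E V k \<subseteq> ?D" by (rule closed_seqs_avoid_leaf[OF E fin x(2) k(1)])
  have cD: "card ?D = falling (card V - 1) k"
    using card_distinct_lists[of "V - {x}" k] fin x k by simp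
  have "card (closed_seqs E V k) = falling (card V - 1) k \<longleftrightarrow> closed_seqs E V k = ?D"
    using card_subset_eq[OF finD sub] cD by auto
  also have "\<dots> \<longleftrightarrow> (\<forall>u\<in>V - {x}. \<forall>v\<in>V - {x}. u \<noteq> v \<longrightarrow> E u v)"
  proof (intro iffI ballI impI)
    fix p q assume eq: "closed_seqs E V k = ?D" and pq: "p \<in> V - {x}" "q \<in> V - {x}" "p \<noteq> q"
    have "card {x, p, q} = 3" "{x, p, q} \<subseteq> V" using pq x(1) by auto
    then have "card (V - {x, p, q}) = card V - 3" by (simp add: card_Diff_subset)
    then have "k - 2 \<le> card (V - {x, p, q})" using k by simp
    then obtain S where S: "S \<subseteq> V - {x, p, q}" "card S = k - 2"
      by (rule obtain_subset_with_card_n)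
    have "finite S" using S fin by (meson finite_Diff finite_subset)
    then obtain xs where xs: "set xs = S" "distinct xs" using finite_distinct_list by blast
    have "length xs = k - 2" using xs S distinct_card by metis
    moreover have "set xs \<subseteq> V - {x}" "p \<notin> set xs" "q \<notin> set xs" using xs(1) S(1) by blast+
    ultimately have "p # q # xs \<in> ?D" using xs(2) pq k by simp
    then have "p # q # xs \<in> closed_seqs E V k" using eq by simp
    then show "E p q" by (simp add: closed_seqs_def)
  next
    assume complete: "\<forall>u\<in>V - {x}. \<forall>v\<in>V - {x}. u \<noteq> v \<longrightarrow> E u v"
    have "?D \<subseteq> closed_seqs E V k"
    proof
      fix xs assume xs: "xs \<in> ?D"
      then have "successively E (xs @ [hd xs])"
        using k complete by (intro successively_closed_complete) auto
      then show "xs \<in> closed_seqs E V k" using xs by (auto simp: closed_seqs_def)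
    qed
    then show "closed_seqs E V k = ?D" using sub by blast
  qed
  finally show ?thesis .
qed

text \<open>
  The common structure of \<open>K\<^bsub>2,3\<^esub>\<close> and \<open>K\<^sub>2 \<or> 3K\<^sub>1\<close>: the two vertices of \<open>T\<close> may or may not be adjacent.
\<close>

definition k23_like :: "('a \<Rightarrow> 'a \<Rightarrow> bool) \<Rightarrow> 'a set \<Rightarrow> bool" where
  "k23_like E V \<longleftrightarrow> (\<exists>I T. V = I \<union> T \<and> I \<inter> T = {} \<and> card I = 3 \<and> card T = 2 \<and>
     (\<forall>x\<in>I. \<forall>t\<in>T. E x t) \<and> (\<forall>x\<in>I. \<forall>y\<in>I. \<not> E x y))"

lemma degree_insert:
  assumes "finite A" "a \<notin> A"
  shows "degree E (insert a A) v = of_bool (E v a) + degree E A v"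
proof -
  have "{u \<in> insert a A. E v u} = (if E v a then insert a {u \<in> A. E v u} else {u \<in> A. E v u})"
    by auto
  then show ?thesis using assms by (simp add: degree_def)
qed

lemma degree_empty: "degree E {} v = 0"
  by (simp add: degree_def)

lemma hamiltonian_5:
  assumes "distinct [a, b, c, d, e]" "V = {a, b, c, d, e}" "E a b" "E b c" "E c d" "E d e" "E e a"
  shows "hamiltonian E V"
proof -
  have "finite V" using assms(2) by simp
  moreover have "set [a, b, c, d, e] = V" using assms(2) by simp
  moreover have "successively E ([a, b, c, d, e] @ [hd [a, b, c, d, e]])" using assms by simp
  ultimately show ?thesis using assms(1) hamiltonian_iff by blast
qed

text \<open>
  The degrees leave at most one edge inside \<open>I\<close>. One such edge \<open>ab\<close> would force the third vertex
  \<open>c\<close> of \<open>I\<close> to be adjacent to both \<open>p\<close> and \<open>q\<close>, and \<open>a\<close>, \<open>b\<close> to be adjacent to different ones of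
  them, which closes a Hamiltonian cycle through \<open>c, p, a, b, q\<close> or \<open>c, q, a, b, p\<close>.
\<close>

lemma k23_like_if_degrees:
  assumes E: "symp E" "irreflp E" and nh: "\<not> hamiltonian E V"
    and I: "V = I \<union> T" "I \<inter> T = {}" "card I = 3" "card T = 2"
    and dI: "\<And>v. v \<in> I \<Longrightarrow> degree E V v = 2" and dT: "\<And>v. v \<in> T \<Longrightarrow> 3 \<le> degree E V v"
  shows "k23_like E V"
proof -
  obtain x y z where xyz: "I = {x, y, z}" "x \<noteq> y" "x \<noteq> z" "y \<noteq> z"
    using I(3) by (auto simp: card_3_iff)
  obtain p q where pq: "T = {p, q}" "p \<noteq> q" using I(4) by (auto simp: card_2_iff)
  have V: "V = {x, y, z, p, q}" using I(1) xyz pq by auto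
  have dist: "x \<noteq> p" "x \<noteq> q" "y \<noteq> p" "y \<noteq> q" "z \<noteq> p" "z \<noteq> q" using I(2) xyz pq by auto
  have deg: "degree E V v = of_bool (E v x) + (of_bool (E v y) + (of_bool (E v z)
               + (of_bool (E v p) + of_bool (E v q))))" for v
    unfolding V using dist xyz pq by (simp add: degree_insert degree_empty)
  have irr: "\<not> E v v" for v using E(2) by (simp add: irreflp_def)
  have sym: "E y x = E x y" "E z x = E x z" "E z y = E y z" "E p x = E x p" "E p y = E y p"
    "E p z = E z p" "E q x = E x q" "E q y = E y q" "E q z = E z q" "E q p = E p q"
    using E(1) by (auto simp: symp_def)
  have ham: "\<not> (E c p \<and> E p a \<and> E a b \<and> E b q \<and> E q c)"
    if "distinct [c, p, a, b, q]" "V = {c, p, a, b, q}" for a b c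
    using hamiltonian_5[OF that] nh by blast
  have perm: "V = {x, p, y, z, q}" "V = {x, p, z, y, q}" "V = {y, p, x, z, q}" "V = {y, p, z, x, q}"
    "V = {z, p, x, y, q}" "V = {z, p, y, x, q}"
    by (simp_all add: V insert_commute)
  have dd: "distinct [x, p, y, z, q]" "distinct [x, p, z, y, q]" "distinct [y, p, x, z, q]"
    "distinct [y, p, z, x, q]" "distinct [z, p, x, y, q]" "distinct [z, p, y, x, q]"
    using dist xyz(2-4) pq(2) by simp_all
  note h = ham[OF dd(1) perm(1)] ham[OF dd(2) perm(2)] ham[OF dd(3) perm(3)] ham[OF dd(4) perm(4)]
    ham[OF dd(5) perm(5)] ham[OF dd(6) perm(6)]
  have d: "degree E V x = 2" "degree E V y = 2" "degree E V z = 2" "3 \<le> degree E V p" "3 \<le> degree E V q"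
    using dI dT xyz pq by auto
  have "(E x p \<and> E x q) \<and> (E y p \<and> E y q) \<and> (E z p \<and> E z q) \<and> \<not> E x y \<and> \<not> E x z \<and> \<not> E y z"
    using d[unfolded deg] h[unfolded sym] unfolding sym
    by (simp only: irr of_bool_eq add_0) (simp only: of_bool_def split: if_splits, simp_all)
  then have "\<forall>a\<in>I. \<forall>t\<in>T. E a t" "\<forall>a\<in>I. \<forall>b\<in>I. \<not> E a b"
    by (simp_all add: xyz(1) pq(1) irr sym)
  then show ?thesis unfolding k23_like_def using I by blast
qed

text \<open>
  Every edge meets \<open>T\<close>, and two vertices cannot meet all five edges of a 5-cycle.
\<close>

lemma k23_like_nonhamiltonian:
  assumes "k23_like E V"
  shows "\<not> hamiltonian E V"
proof
  obtain I T where I: "V = I \<union> T" "I \<inter> T = {}" "card I = 3" "card T = 2"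
    and nE: "\<And>x y. x \<in> I \<Longrightarrow> y \<in> I \<Longrightarrow> \<not> E x y"
    using assms by (auto simp: k23_like_def)
  have fin: "finite I" "finite T" using I by (auto intro: card_ge_0_finite)
  have cV: "card V = 5" using I fin by (simp add: card_Un_disjoint)
  assume "hamiltonian E V"
  then obtain xs where xs: "xs \<in> closed_seqs E V 5" using cV by (auto simp: hamiltonian_def)
  then have "length xs = 5" by (simp add: closed_seqs_def)
  then obtain a b c d e where xs': "xs = [a, b, c, d, e]"
    by (auto simp: eval_nat_numeral length_Suc_conv)
  have dist: "distinct [a, b, c, d, e]" and sub: "{a, b, c, d, e} \<subseteq> V"
    and cl: "E a b" "E b c" "E c d" "E d e" "E e a"
    using xs xs' by (auto simp: closed_seqs_def)
  have inT: "a \<in> T \<or> b \<in> T" "b \<in> T \<or> c \<in> T" "c \<in> T \<or> d \<in> T" "d \<in> T \<or> e \<in> T" "e \<in> T \<or> a \<in> T"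
    using cl nE sub I(1) by auto
  have "degree (\<lambda>_ v. v \<in> T) {a, b, c, d, e} a \<le> card T"
    unfolding degree_def using fin by (intro card_mono) auto
  moreover have "degree (\<lambda>_ v. v \<in> T) {a, b, c, d, e} a = of_bool (a \<in> T) + (of_bool (b \<in> T) +
      (of_bool (c \<in> T) + (of_bool (d \<in> T) + of_bool (e \<in> T))))"
    using dist by (simp add: degree_insert degree_empty)
  ultimately show False using inT I(4)
    by (cases "a \<in> T"; cases "b \<in> T"; cases "c \<in> T"; cases "d \<in> T"; cases "e \<in> T"; simp)
qed

lemma card_k23_like:
  assumes "k23_like E V"
  shows "card V = 5" "finite V"
proof -
  obtain I T where I: "V = I \<union> T" "I \<inter> T = {}" "card I = 3" "card T = 2"
    using assms by (auto simp: k23_like_def)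
  then have "finite I" "finite T" by (auto intro: card_ge_0_finite)
  then show "card V = 5" "finite V" using I by (simp_all add: card_Un_disjoint)
qed

text \<open>
  Each of the three 4-cycles alternates between \<open>T\<close> and a pair in \<open>I\<close> and is traced 8 times.
\<close>

lemma card_closed_seqs_k23_like:
  assumes E: "symp E" and K: "k23_like E V"
  shows "24 \<le> card (closed_seqs E V 4)"
proof -
  obtain I T where I: "V = I \<union> T" "I \<inter> T = {}" "card I = 3" "card T = 2"
    and adj: "\<And>x t. x \<in> I \<Longrightarrow> t \<in> T \<Longrightarrow> E x t"
    using K by (auto simp: k23_like_def)
  obtain x y z where xyz: "I = {x, y, z}" "x \<noteq> y" "x \<noteq> z" "y \<noteq> z"
    using I(3) by (auto simp: card_3_iff)
  obtain p q where pq: "T = {p, q}" "p \<noteq> q" using I(4) by (auto simp: card_2_iff)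
  have dist: "x \<noteq> p" "x \<noteq> q" "y \<noteq> p" "y \<noteq> q" "z \<noteq> p" "z \<noteq> q" using I(2) xyz pq by auto
  let ?P = "[(x, y), (y, x), (x, z), (z, x), (y, z), (z, y)]"
  define L where "L = map (\<lambda>(a, b). [a, p, b, q]) ?P @ map (\<lambda>(a, b). [a, q, b, p]) ?P
          @ map (\<lambda>(a, b). [p, a, q, b]) ?P @ map (\<lambda>(a, b). [q, a, p, b]) ?P"
  have "distinct L" unfolding L_def using dist xyz(2-4) pq(2) by simp
  then have "card (set L) = length L" by (rule distinct_card)
  also have "length L = 24" by (simp add: L_def)
  finally have card_L: "card (set L) = 24" .
  have adj': "E a t" "E t a" if "a \<in> I" "t \<in> T" for a t
    using adj that E by (auto simp: symp_def)
  have "set L \<subseteq> closed_seqs E V 4"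
  proof -
    have "[a, t, b, s] \<in> closed_seqs E V 4 \<and> [t, a, s, b] \<in> closed_seqs E V 4"
      if "a \<in> I" "b \<in> I" "t \<in> T" "s \<in> T" "a \<noteq> b" "t \<noteq> s" for a b t s
      using that adj' I(1,2) by (auto simp: closed_seqs_def)
    then show ?thesis using xyz pq by (simp add: L_def)
  qed
  moreover have "finite (closed_seqs E V 4)"
    by (rule finite_subset[OF _ finite_lists_length_eq[of V 4]])
      (auto simp: closed_seqs_def card_k23_like[OF K])
  ultimately show ?thesis using card_mono[of "closed_seqs E V 4" "set L"] card_L by simp
qed

lemma card_inner_paths_2_same_end:
  assumes "finite V" "symp E"
  shows "card (inner_paths E (V - {u}) 2 u u) \<le> degree E V u * (degree E V u - 1)"
proof -
  let ?N = "{x \<in> V. E u x}"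
  have fin: "finite (Sigma ?N (\<lambda>x. ?N - {x}))" using assms(1) by auto
  have "inner_paths E (V - {u}) 2 u u \<subseteq> (\<lambda>(x, y). [x, y]) ` Sigma ?N (\<lambda>x. ?N - {x})"
  proof
    fix xs assume xs: "xs \<in> inner_paths E (V - {u}) 2 u u"
    then obtain x y where xy: "xs = [x, y]"
      by (auto simp: inner_paths_def numeral_2_eq_2 length_Suc_conv)
    have "(x, y) \<in> Sigma ?N (\<lambda>x. ?N - {x})"
      using xs assms(2) by (auto simp: xy inner_paths_def symp_def)
    then show "xs \<in> (\<lambda>(x, y). [x, y]) ` Sigma ?N (\<lambda>x. ?N - {x})"
      by (rule rev_image_eqI) (simp add: xy)
  qed
  then have "card (inner_paths E (V - {u}) 2 u u) \<le> card (Sigma ?N (\<lambda>x. ?N - {x}))"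
    using fin card_image_le[OF fin] card_mono[OF finite_imageI[OF fin]] le_trans by blast
  also have "\<dots> = degree E V u * (degree E V u - 1)"
    using assms(1) by (simp add: degree_def)
  finally show ?thesis .
qed

text \<open>
  With \<open>h\<close>, \<open>R\<close>, \<open>T\<close> from the degree theorem, the degree sum falls short of \<open>(n-1)(n-2)\<close> by at least
  \<open>g (g + 2 + 2t) + 2t\<close>, where \<open>h = g + 2\<close> and \<open>n = 2h + 1 + t\<close>. This vanishes only for \<open>n = 5\<close>,
  \<open>h = 2\<close>. There \<open>k = 3\<close> is still strict, as a vertex of degree 2 lies on at most one triangle, and for
  \<open>k = 4\<close> every estimate has to be tight.
\<close>

theorem card_closed_seqs_nonhamiltonian:
  assumes E: "symp E" "irreflp E" and fin: "finite V" and nh: "\<not> hamiltonian E V"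
    and k: "3 \<le> k" "k \<le> card V - 1"
  shows "card (closed_seqs E V k) \<le> falling (card V - 1) k"
    and "card (closed_seqs E V k) = falling (card V - 1) k \<Longrightarrow>
      (\<exists>x\<in>V. degree E V x \<le> 1) \<or> (card V = 5 \<and> k = 4 \<and> k23_like E V)"
proof -
  define n where "n = card V"
  have n: "4 \<le> n" using k by (simp add: n_def)
  obtain h R T where h: "1 \<le> h" "2 * h < n" and RT: "R \<subseteq> V" "T \<subseteq> V" "R \<inter> T = {}"
    "card R = h" "card T = h" and dR: "\<And>v. v \<in> R \<Longrightarrow> degree E V v \<le> h"
    and dM: "\<And>v. v \<in> V - R - T \<Longrightarrow> degree E V v \<le> n - h - 1"
    unfolding n_def by (rule nonhamiltonian_degrees[OF fin _ E nh]) (use n in \<open>auto simp: n_def\<close>)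
  define F where "F = falling (n - 3) (k - 2)"
  have Fpos: "0 < F" unfolding F_def using k by (intro falling_pos) (simp add: n_def)
  have target: "falling (n - 1) k = (n - 1) * (n - 2) * F"
  proof -
    have "k = Suc (Suc (k - 2))" using k by simp
    then have "falling (n - 1) k = (n - 1) * ((n - 1 - 1) * falling (n - 1 - 1 - 1) (k - 2))"
      by (metis falling.simps(2))
    moreover have "n - 1 - 1 = n - 2" "n - 1 - 1 - 1 = n - 3" by simp_all
    ultimately show ?thesis by (simp only: F_def mult.assoc)
  qed
  have "card (closed_seqs E V k) \<le> falling (n - 1) k \<and>
    (card (closed_seqs E V k) = falling (n - 1) k \<longrightarrow>
      (\<exists>x\<in>V. degree E V x \<le> 1) \<or> (n = 5 \<and> k = 4 \<and> k23_like E V))"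
  proof (cases "h = 1")
    case True
    then obtain x where "x \<in> V" "degree E V x \<le> 1"
      using RT dR by (metis card_1_singletonE insert_subset singletonI)
    then show ?thesis
      using card_closed_seqs_leaf_le[OF E(1) fin _ _ k] by (auto simp: n_def)
  next
    case False
    obtain g where g: "h = g + 2" using False h by (metis One_nat_def Suc_1 add.commute le_Suc_ex le_antisym not_less_eq_eq)
    obtain t where t: "n = 2 * h + 1 + t" using h by (metis Suc_eq_plus1 Suc_leI le_Suc_ex)
    let ?S = "\<Sum>v\<in>V. min (degree E V v) (n - 2)"
    have S: "?S \<le> h * h + (n - 2 * h) * (n - h - 1) + h * (n - 2)"
    proof -
      have "?S \<le> card R * h + (card V - card R - card T) * (n - h - 1) + card T * (n - 2)"
        by (rule degree_sum_bound[OF fin RT(1-3)]) (use dR dM in \<open>force simp: min_def\<close>)+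
      then show ?thesis using RT by (simp add: n_def mult_2)
    qed
    have cl: "card (closed_seqs E V k) \<le> ?S * F"
      using card_closed_seqs_le_degrees[OF E fin nh k(1)] by (simp add: n_def F_def)
    have poly: "h * h + (n - 2 * h) * (n - h - 1) + h * (n - 2) + (g * (g + 2 + 2 * t) + 2 * t)
                  = (n - 1) * (n - 2)"
    proof -
      have "n - 2 * h = t + 1" "n - h - 1 = g + t + 2" "n - 2 = 2 * g + t + 3" "n - 1 = 2 * g + t + 4"
        using t g by simp_all
      then show ?thesis unfolding g by (simp add: algebra_simps)
    qed
    show ?thesis
    proof (cases "g = 0 \<and> t = 0")
      case False
      then have "?S < (n - 1) * (n - 2)" using S poly by auto
      then have "?S * F < (n - 1) * (n - 2) * F" using Fpos by (rule mult_strict_right_mono)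
      then have "card (closed_seqs E V k) < falling (n - 1) k"
        unfolding target using cl by (rule le_less_trans[rotated])
      then show ?thesis by simp
    next
      case True
      then have n5: "n = 5" "h = 2" using g t by auto
      have S12: "?S \<le> 12" using S n5 by simp
      consider "k = 3" | "k = 4" using k n5 by (force simp: n_def)
      then show ?thesis
      proof cases
        case 1
        let ?g = "\<lambda>u. card (inner_paths E (V - {u}) 2 u u)"
        have gmin: "?g u \<le> min (degree E V u) 3 * 2" if "u \<in> V" for u
          using card_closed_seqs_at_vertex[OF E fin nh that, of 1] n5
          by (simp add: n_def numeral_2_eq_2)
        \<comment> \<open>For vertices in \<open>R\<close> the general bound 4 improves to 2, which brings the total from 24 down to 20.\<close>
        have "(\<Sum>u\<in>V. ?g u) \<le> card R * 2 + (card V - card R - card T) * 4 + card T * 6"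
        proof (rule degree_sum_bound[OF fin RT(1-3), where f = "\<lambda>x. x"])
          show "?g u \<le> 2" if u: "u \<in> R" for u
          proof -
            have "degree E V u * (degree E V u - 1) \<le> 2 * (2 - 1)"
              using dR[OF u] n5 by (intro mult_le_mono diff_le_mono) auto
            then show ?thesis using card_inner_paths_2_same_end[OF fin E(1), of u] by simp
          qed
          show "?g u \<le> 4" if u: "u \<in> V - R - T" for u
            using gmin[of u] dM[OF u] n5 u by simp
          show "?g u \<le> 6" if u: "u \<in> T" for u
            using gmin[of u] RT(2) u by auto
        qed
        also have "\<dots> = 20" using RT n5 by (simp add: n_def)
        finally have "card (closed_seqs E V k) \<le> 20"
          using card_closed_seqs_Suc[OF fin, of E 2] 1 by (simp add: numeral_3_eq_3 numeral_2_eq_2)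
        moreover have "falling (n - 1) k = 24" using 1 n5 by (simp add: eval_nat_numeral)
        ultimately show ?thesis by simp
      next
        case 2
        have F2: "F = 2" using 2 n5 by (simp add: F_def eval_nat_numeral)
        have "card (closed_seqs E V k) \<le> falling (n - 1) k"
          using cl S12 target F2 n5 by simp
        moreover have "k23_like E V" if eq: "card (closed_seqs E V k) = falling (n - 1) k"
        proof -
          have "?S = 12" using cl S12 target F2 n5 eq by simp
          also have "12 = (\<Sum>v\<in>V. if v \<in> T then 3 else 2 :: nat)"
          proof -
            have "V \<inter> {v. v \<in> T} = T" "card (V \<inter> - {v. v \<in> T}) = 3"
              using RT fin n5 card_Diff_subset[of T V] by (auto simp: n_def Diff_eq[symmetric] finite_subset Int_absorb1)
            then show ?thesis using RT fin n5 by (simp add: sum.If_cases)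
          qed
          finally have sumeq: "?S = (\<Sum>v\<in>V. if v \<in> T then 3 else 2)" .
          have le: "min (degree E V v) (n - 2) \<le> (if v \<in> T then 3 else 2)" if "v \<in> V" for v
          proof (cases "v \<in> T")
            case False
            then have "degree E V v \<le> 2" using dR[of v] dM[of v] n5 that by (cases "v \<in> R") auto
            then show ?thesis using False n5 by simp
          qed (use n5 in simp)
          have mineq: "min (degree E V v) (n - 2) = (if v \<in> T then 3 else 2)" if "v \<in> V" for v
            by (rule sum_mono_inv[OF sumeq le that fin])
          show ?thesis
          proof (rule k23_like_if_degrees[OF E nh])
            show "V = (V - T) \<union> T" "(V - T) \<inter> T = {}" "card T = 2" using RT n5 by auto
            show "card (V - T) = 3"
              using RT fin n5 by (simp add: card_Diff_subset n_def finite_subset)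
            show "degree E V v = 2" if "v \<in> V - T" for v
              using mineq[of v] that n5 by (auto simp: min_def split: if_splits)
            show "3 \<le> degree E V v" if "v \<in> T" for v
              using mineq[of v] that n5 RT(2) by (auto simp: min_def split: if_splits)
          qed
        qed
        ultimately show ?thesis using n5 2 by blast
      qed
    qed
  qed
  then show "card (closed_seqs E V k) \<le> falling (card V - 1) k"
    and "card (closed_seqs E V k) = falling (card V - 1) k \<Longrightarrow>
      (\<exists>x\<in>V. degree E V x \<le> 1) \<or> (card V = 5 \<and> k = 4 \<and> k23_like E V)"
    by (auto simp: n_def)
qed

theorem extremal_nonhamiltonian_iff:
  assumes E: "symp E" "irreflp E" and fin: "finite V" and k: "3 \<le> k" "k \<le> card V - 1"
  shows "\<not> hamiltonian E V \<and> card (closed_seqs E V k) = falling (card V - 1) k \<longleftrightarrow>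
    (\<exists>x\<in>V. degree E V x \<le> 1 \<and> (\<forall>u\<in>V - {x}. \<forall>v\<in>V - {x}. u \<noteq> v \<longrightarrow> E u v)) \<or>
    (card V = 5 \<and> k = 4 \<and> k23_like E V)"
    (is "?L \<longleftrightarrow> ?R")
proof
  assume ?L
  then have eq: "card (closed_seqs E V k) = falling (card V - 1) k"
    and *: "(\<exists>x\<in>V. degree E V x \<le> 1) \<or> (card V = 5 \<and> k = 4 \<and> k23_like E V)"
    using card_closed_seqs_nonhamiltonian(2)[OF E fin _ k] by auto
  from * show ?R
  proof
    assume "\<exists>x\<in>V. degree E V x \<le> 1"
    then obtain x where "x \<in> V" "degree E V x \<le> 1" by blast
    then show ?R using card_closed_seqs_leaf_eq_iff[OF E(1) fin _ _ k, of x] eq by blast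
  qed simp
next
  assume ?R
  then show ?L
  proof
    assume "\<exists>x\<in>V. degree E V x \<le> 1 \<and> (\<forall>u\<in>V - {x}. \<forall>v\<in>V - {x}. u \<noteq> v \<longrightarrow> E u v)"
    then obtain x where "x \<in> V" "degree E V x \<le> 1" "\<forall>u\<in>V - {x}. \<forall>v\<in>V - {x}. u \<noteq> v \<longrightarrow> E u v"
      by blast
    then show ?L
      using card_closed_seqs_leaf_eq_iff[OF E(1) fin _ _ k, of x] nonhamiltonian_leaf[OF E(1) fin, of x] k
      by simp
  next
    assume K: "card V = 5 \<and> k = 4 \<and> k23_like E V"
    then have nh: "\<not> hamiltonian E V" using k23_like_nonhamiltonian by blast
    have "24 \<le> card (closed_seqs E V k)" using card_closed_seqs_k23_like[OF E(1)] K by blast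
    moreover have "falling (card V - 1) k = 24" using K by (simp add: eval_nat_numeral)
    ultimately show ?L using nh card_closed_seqs_nonhamiltonian(1)[OF E fin nh k] by simp
  qed
qed

section \<open>Isomorphisms and copies of cycles\<close>

abbreviation adj :: "'a pair_pre_digraph \<Rightarrow> 'a \<Rightarrow> 'a \<Rightarrow> bool" where
  "adj G u v \<equiv> (u, v) \<in> parcs G"

lemma pair_graph_iff:
  "pair_graph G \<longleftrightarrow> finite (pverts G) \<and> (\<forall>u v. (u, v) \<in> parcs G \<longrightarrow>
     u \<in> pverts G \<and> v \<in> pverts G \<and> u \<noteq> v \<and> (v, u) \<in> parcs G)"
proof
  assume "pair_graph G"
  then interpret pair_graph G .
  show "finite (pverts G) \<and> (\<forall>u v. (u, v) \<in> parcs G \<longrightarrow>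
     u \<in> pverts G \<and> v \<in> pverts G \<and> u \<noteq> v \<and> (v, u) \<in> parcs G)"
    using pair_finite_verts wellformed' no_loops' arcs_symmetric by blast
next
  assume *: "finite (pverts G) \<and> (\<forall>u v. (u, v) \<in> parcs G \<longrightarrow>
     u \<in> pverts G \<and> v \<in> pverts G \<and> u \<noteq> v \<and> (v, u) \<in> parcs G)"
  have "parcs G \<subseteq> pverts G \<times> pverts G" using * by auto
  then have "finite (parcs G)" using * finite_subset by blast
  then show "pair_graph G"
    using * by unfold_locales (auto simp: symmetric_def intro!: symI)
qed

lemma pair_wf_digraph_iff: "pair_wf_digraph G \<longleftrightarrow> parcs G \<subseteq> pverts G \<times> pverts G"
  by (auto simp: pair_wf_digraph_def)

text \<open>
  An isomorphism of the underlying digraphs also carries a map on arcs and its own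
  projections; as the arcs are pairs, all of these are determined by the map on vertices.
\<close>

lemma graph_iso_iff_image:
  "graph_iso G H \<longleftrightarrow> pair_wf_digraph G \<and>
     (\<exists>f. inj_on f (pverts G) \<and> pverts H = f ` pverts G \<and> parcs H = map_prod f f ` parcs G)"
proof
  assume "graph_iso G H"
  then obtain h where h: "pre_digraph.digraph_isomorphism (with_proj G) h"
    and H: "with_proj H = app_iso h (with_proj G)"
    unfolding graph_iso_def digraph_iso_def by blast
  let ?f = "iso_verts h"
  have "fst = iso_tail h" "snd = iso_head h" "pverts H = ?f ` pverts G" "parcs H = iso_arcs h ` parcs G"
    using arg_cong[OF H, of tail] arg_cong[OF H, of head] arg_cong[OF H, of verts]
      arg_cong[OF H, of arcs] by simp_all
  moreover from h have "pair_wf_digraph G" "inj_on ?f (pverts G)"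
    "\<And>a. a \<in> parcs G \<Longrightarrow> ?f (fst a) = iso_tail h (iso_arcs h a) \<and> ?f (snd a) = iso_head h (iso_arcs h a)"
    by (simp_all add: pre_digraph.digraph_isomorphism_def wf_digraph_wp_iff)
  ultimately have "iso_arcs h a = map_prod ?f ?f a" if "a \<in> parcs G" for a
    using that by (metis map_prod_simp prod.collapse)
  then have "parcs H = map_prod ?f ?f ` parcs G"
    using \<open>parcs H = iso_arcs h ` parcs G\<close> by (metis (no_types, lifting) image_cong)
  then show "pair_wf_digraph G \<and>
     (\<exists>f. inj_on f (pverts G) \<and> pverts H = f ` pverts G \<and> parcs H = map_prod f f ` parcs G)"
    using \<open>pair_wf_digraph G\<close> \<open>inj_on ?f (pverts G)\<close> \<open>pverts H = ?f ` pverts G\<close> by blast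
next
  assume "pair_wf_digraph G \<and>
     (\<exists>f. inj_on f (pverts G) \<and> pverts H = f ` pverts G \<and> parcs H = map_prod f f ` parcs G)"
  then obtain f where wf: "pair_wf_digraph G" and f: "inj_on f (pverts G)" "pverts H = f ` pverts G"
    "parcs H = map_prod f f ` parcs G" by blast
  define h where "h = \<lparr> iso_verts = f, iso_arcs = map_prod f f, iso_head = snd, iso_tail = fst \<rparr>"
  have "inj_on (map_prod f f) (parcs G)"
    using wf by (intro inj_on_subset[OF map_prod_inj_on[OF f(1) f(1)]]) (simp add: pair_wf_digraph_iff)
  then have "pre_digraph.digraph_isomorphism (with_proj G) h"
    using wf f(1) by (simp add: pre_digraph.digraph_isomorphism_def wf_digraph_wp_iff h_def)
  moreover have "with_proj H = app_iso h (with_proj G)"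
    using f by (simp add: with_proj_def app_iso_def h_def)
  ultimately show "graph_iso G H" unfolding graph_iso_def digraph_iso_def by blast
qed

lemma graph_iso_iff:
  assumes "pair_wf_digraph H"
  shows "graph_iso G H \<longleftrightarrow> pair_wf_digraph G \<and>
     (\<exists>f. bij_betw f (pverts G) (pverts H) \<and>
        (\<forall>u\<in>pverts G. \<forall>v\<in>pverts G. (u, v) \<in> parcs G \<longleftrightarrow> (f u, f v) \<in> parcs H))"
proof -
  have "inj_on f (pverts G) \<and> pverts H = f ` pverts G \<and> parcs H = map_prod f f ` parcs G \<longleftrightarrow>
      bij_betw f (pverts G) (pverts H) \<and>
        (\<forall>u\<in>pverts G. \<forall>v\<in>pverts G. (u, v) \<in> parcs G \<longleftrightarrow> (f u, f v) \<in> parcs H)"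
    (is "?L \<longleftrightarrow> ?R") if wf: "pair_wf_digraph G" for f
  proof
    assume L: ?L
    then have "(f u, f v) \<in> parcs H" if "(u, v) \<in> parcs G" for u v using that by auto
    moreover have "(u, v) \<in> parcs G" if uv: "u \<in> pverts G" "v \<in> pverts G" "(f u, f v) \<in> parcs H" for u v
    proof -
      obtain x y where xy: "(x, y) \<in> parcs G" "f x = f u" "f y = f v" using L uv(3) by auto
      then have "x \<in> pverts G" "y \<in> pverts G" using wf by (auto simp: pair_wf_digraph_iff)
      then show ?thesis using xy L uv by (metis inj_onD)
    qed
    ultimately show ?R using L unfolding bij_betw_def by blast
  next
    assume R: ?R
    then have "pverts H = f ` pverts G" by (simp add: bij_betw_def)
    have "parcs H = map_prod f f ` parcs G"
    proof (intro equalityI subsetI)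
      fix e assume e: "e \<in> parcs H"
      then have "e \<in> f ` pverts G \<times> f ` pverts G"
        using assms \<open>pverts H = f ` pverts G\<close> by (auto simp: pair_wf_digraph_iff)
      then obtain u v where uv: "u \<in> pverts G" "v \<in> pverts G" "e = (f u, f v)" by auto
      then have "(u, v) \<in> parcs G" using R e by blast
      then show "e \<in> map_prod f f ` parcs G" using uv(3) by (auto intro: rev_image_eqI)
    next
      fix e assume "e \<in> map_prod f f ` parcs G"
      then obtain u v where "(u, v) \<in> parcs G" "e = (f u, f v)" by auto
      moreover from this have "u \<in> pverts G" "v \<in> pverts G" using wf by (auto simp: pair_wf_digraph_iff)
      ultimately show "e \<in> parcs H" using R by blast
    qed
    then show ?L using R by (simp add: bij_betw_def)
  qed
  then show ?thesis unfolding graph_iso_iff_image by blast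
qed

lemma graph_iso_sym:
  assumes "graph_iso G H" and "pair_wf_digraph H"
  shows "graph_iso H G"
proof -
  obtain f where wf: "pair_wf_digraph G" and f: "bij_betw f (pverts G) (pverts H)"
    "\<And>u v. u \<in> pverts G \<Longrightarrow> v \<in> pverts G \<Longrightarrow> (u, v) \<in> parcs G \<longleftrightarrow> (f u, f v) \<in> parcs H"
    using assms by (auto simp: graph_iso_iff)
  let ?g = "the_inv_into (pverts G) f"
  have g: "bij_betw ?g (pverts H) (pverts G)" by (rule bij_betw_the_inv_into[OF f(1)])
  have "(x, y) \<in> parcs H \<longleftrightarrow> (?g x, ?g y) \<in> parcs G" if "x \<in> pverts H" "y \<in> pverts H" for x y
    using f(2)[of "?g x" "?g y"] that bij_betwE[OF g] f_the_inv_into_f_bij_betw[OF f(1)] by simp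
  then show ?thesis unfolding graph_iso_iff[OF wf] using assms(2) g by blast
qed

lemma subgraph_with_proj:
  "subgraph (with_proj S) (with_proj G) \<longleftrightarrow>
     pverts S \<subseteq> pverts G \<and> parcs S \<subseteq> parcs G \<and> pair_wf_digraph S \<and> pair_wf_digraph G"
  by (auto simp: subgraph_def compatible_def wf_digraph_wp_iff)

text \<open>
  The copy of a cycle graph traced by a sequence, as the image of the cycle graph under
  \<open>i \<mapsto> xs ! i\<close>. It is meant for distinct \<open>xs\<close> of length at least 3.
\<close>

definition cycle_on :: "'a list \<Rightarrow> 'a pair_pre_digraph" where
  "cycle_on xs = \<lparr> pverts = set xs,
     parcs = map_prod ((!) xs) ((!) xs) ` parcs (cycle_graph (length xs)) \<rparr>"

lemma parcs_cycle_graph: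
  "parcs (cycle_graph k) = (\<lambda>i. (i, Suc i mod k)) ` {..<k} \<union> (\<lambda>i. (Suc i mod k, i)) ` {..<k}"
  by (auto simp: cycle_graph_def)

lemma adj_cycle_on:
  "adj (cycle_on xs) u v \<longleftrightarrow> (\<exists>i<length xs. (u = xs ! i \<and> v = xs ! (Suc i mod length xs)) \<or>
     (v = xs ! i \<and> u = xs ! (Suc i mod length xs)))"
  by (auto simp: cycle_on_def parcs_cycle_graph image_Un image_image)

lemma closed_iff_cycle_on:
  assumes "xs \<noteq> []" and "symp E"
  shows "successively E (xs @ [hd xs]) \<longleftrightarrow> (\<forall>u v. adj (cycle_on xs) u v \<longrightarrow> E u v)"
  unfolding successively_closed_nth[OF assms(1)] adj_cycle_on
  using assms(2) unfolding symp_def by blast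

lemma pair_graph_cycle_graph:
  assumes "2 \<le> k" shows "pair_graph (cycle_graph k)"
  using assms unfolding pair_graph_iff
  by (auto simp: cycle_graph_def mod_Suc split: if_splits)

lemma card_parcs_cycle_graph:
  assumes "3 \<le> k" shows "card (parcs (cycle_graph k)) = 2 * k"
proof -
  let ?A = "(\<lambda>i. (i, Suc i mod k)) ` {..<k}" and ?B = "(\<lambda>i. (Suc i mod k, i)) ` {..<k}"
  have "parcs (cycle_graph k) = ?A \<union> ?B" by (rule parcs_cycle_graph)
  moreover have "?A \<inter> ?B = {}" using assms by (auto simp: mod_Suc split: if_splits)
  moreover have "card ?A = k" "card ?B = k" by (auto simp: card_image inj_on_def)
  ultimately show ?thesis by (simp add: card_Un_disjoint)
qed

lemma graph_iso_cycle_on: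
  assumes "distinct xs"
  shows "graph_iso (cycle_graph (length xs)) (cycle_on xs)"
proof -
  have "inj_on ((!) xs) {..<length xs}" using assms by (simp add: inj_on_nth)
  moreover have "set xs = (!) xs ` {..<length xs}" by (auto simp: in_set_conv_nth)
  moreover have "pair_wf_digraph (cycle_graph (length xs))"
    by (auto simp: pair_wf_digraph_iff cycle_graph_def)
  ultimately show ?thesis
    unfolding graph_iso_iff_image by (auto simp: cycle_on_def cycle_graph_def)
qed

lemma pair_graph_if_iso:
  assumes "graph_iso G H" and "pair_graph H"
  shows "pair_graph G" and "card (pverts G) = card (pverts H)"
proof -
  have wf: "pair_wf_digraph H" using assms(2) by (auto simp: pair_graph_iff pair_wf_digraph_iff)
  obtain f where wfG: "pair_wf_digraph G" and f: "bij_betw f (pverts G) (pverts H)"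
    "\<And>u v. u \<in> pverts G \<Longrightarrow> v \<in> pverts G \<Longrightarrow> (u, v) \<in> parcs G \<longleftrightarrow> (f u, f v) \<in> parcs H"
    using assms(1) by (auto simp: graph_iso_iff[OF wf])
  have "u \<in> pverts G \<and> v \<in> pverts G \<and> u \<noteq> v \<and> (v, u) \<in> parcs G" if e: "(u, v) \<in> parcs G" for u v
  proof -
    have uv: "u \<in> pverts G" "v \<in> pverts G" using e wfG by (auto simp: pair_wf_digraph_iff)
    then have "(f u, f v) \<in> parcs H" using e f(2) by simp
    then have "f u \<noteq> f v" "(f v, f u) \<in> parcs H" using assms(2) by (auto simp: pair_graph_iff)
    then show ?thesis using uv f(2) by auto
  qed
  moreover have "finite (pverts G)"
    using assms(2) bij_betw_finite[OF f(1)] by (simp add: pair_graph_iff)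
  ultimately show "pair_graph G" by (auto simp: pair_graph_iff)
  show "card (pverts G) = card (pverts H)" by (rule bij_betw_same_card[OF f(1)])
qed

lemma pair_graph_cycle_on:
  assumes "distinct xs" "2 \<le> length xs" shows "pair_graph (cycle_on xs)"
proof (rule pair_graph_if_iso)
  have "pair_graph (cycle_graph (length xs))" using assms(2) by (rule pair_graph_cycle_graph)
  moreover have "pair_wf_digraph (cycle_on xs)"
    by (auto simp: pair_wf_digraph_iff cycle_on_def cycle_graph_def)
  ultimately show "graph_iso (cycle_on xs) (cycle_graph (length xs))"
    using graph_iso_sym graph_iso_cycle_on[OF assms(1)] by blast
qed (rule pair_graph_cycle_graph[OF assms(2)])

theorem copies_cycle_graph:
  assumes G: "pair_graph G" and k: "3 \<le> k"
  shows "copies (cycle_graph k) G = cycle_on ` closed_seqs (adj G) (pverts G) k"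
proof (intro equalityI subsetI)
  have sym: "symp (adj G)" and wfG: "pair_wf_digraph G"
    using G by (auto simp: pair_graph_iff symp_def pair_wf_digraph_iff)
  have wfC: "pair_wf_digraph (cycle_graph k)" by (auto simp: pair_wf_digraph_iff cycle_graph_def)
  {
    fix S assume "S \<in> copies (cycle_graph k) G"
    then have S: "subgraph (with_proj S) (with_proj G)" "graph_iso S (cycle_graph k)"
      by (auto simp: copies_def)
    from graph_iso_sym[OF S(2) wfC] obtain g where g: "inj_on g {..<k}"
      "pverts S = g ` {..<k}" "parcs S = map_prod g g ` parcs (cycle_graph k)"
      unfolding graph_iso_iff_image by (auto simp: cycle_graph_def)
    define xs where "xs = map g [0..<k]"
    have xs: "length xs = k" "distinct xs" "set xs = pverts S"
      using g(1,2) by (auto simp: xs_def distinct_map atLeast0LessThan)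
    have "map_prod ((!) xs) ((!) xs) ` parcs (cycle_graph k) = map_prod g g ` parcs (cycle_graph k)"
      by (intro image_cong refl) (auto simp: xs_def cycle_graph_def)
    then have SC: "S = cycle_on xs" using g xs by (simp add: cycle_on_def)
    have "xs \<noteq> []" using xs k by auto
    then have "successively (adj G) (xs @ [hd xs])"
      using S(1) SC closed_iff_cycle_on[OF _ sym] by (auto simp: subgraph_with_proj)
    then show "S \<in> cycle_on ` closed_seqs (adj G) (pverts G) k"
      using xs S(1) SC by (auto simp: closed_seqs_def subgraph_with_proj)
  next
    fix S assume "S \<in> cycle_on ` closed_seqs (adj G) (pverts G) k"
    then obtain xs where SC: "S = cycle_on xs" and xs: "length xs = k" "distinct xs"
      "set xs \<subseteq> pverts G" "successively (adj G) (xs @ [hd xs])"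
      by (auto simp: closed_seqs_def)
    have "xs \<noteq> []" using xs k by auto
    then have "parcs S \<subseteq> parcs G" using xs(4) closed_iff_cycle_on[OF _ sym] by (auto simp: SC)
    moreover have pg: "pair_graph S" using pair_graph_cycle_on[of xs] xs k by (simp add: SC)
    moreover from pg have wfS: "pair_wf_digraph S" by (auto simp: pair_graph_iff pair_wf_digraph_iff)
    moreover have "graph_iso S (cycle_graph k)"
      using graph_iso_sym[OF graph_iso_cycle_on[OF xs(2)]] wfS xs(1) by (simp add: SC)
    moreover have "pverts S \<subseteq> pverts G" using xs(3) by (simp add: SC cycle_on_def)
    ultimately show "S \<in> copies (cycle_graph k) G"
      using wfG by (simp add: copies_def subgraph_with_proj)
  }
qed

lemma graph_free_cycle_graph_iff:
  assumes "pair_graph G" and "3 \<le> card (pverts G)"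
  shows "graph_free (cycle_graph (card (pverts G))) G \<longleftrightarrow> \<not> hamiltonian (adj G) (pverts G)"
  unfolding graph_free_def copies_cycle_graph[OF assms] hamiltonian_def by simp

lemma card_parcs_cycle_on:
  assumes "distinct xs" "3 \<le> length xs"
  shows "card (parcs (cycle_on xs)) = 2 * length xs"
proof -
  have "inj_on ((!) xs) {..<length xs}" using assms by (simp add: inj_on_nth)
  then have "inj_on (map_prod ((!) xs) ((!) xs)) (parcs (cycle_graph (length xs)))"
    by (intro inj_on_subset[OF map_prod_inj_on]) (auto simp: cycle_graph_def)
  then show ?thesis using card_parcs_cycle_graph[OF assms(2)] by (simp add: cycle_on_def card_image)
qed

text \<open>
  Both graphs have the same number of arcs, so one inclusion between the arc sets suffices.
\<close>

lemma cycle_on_eq_if_closed: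
  assumes "distinct xs" "distinct ys" "set ys = set xs" "3 \<le> length xs"
    and cl: "successively (adj (cycle_on xs)) (ys @ [hd ys])"
  shows "cycle_on ys = cycle_on xs"
proof -
  have len: "length ys = length xs" using assms(1-3) distinct_card by metis
  have "pair_graph (cycle_on xs)" using assms by (intro pair_graph_cycle_on) auto
  then interpret pair_graph "cycle_on xs" .
  have "symp (adj (cycle_on xs))" by (auto simp: symp_def dest: arcs_symmetric)
  moreover have "ys \<noteq> []" using len assms(4) by auto
  ultimately have "parcs (cycle_on ys) \<subseteq> parcs (cycle_on xs)"
    using cl closed_iff_cycle_on by auto
  then have "parcs (cycle_on ys) = parcs (cycle_on xs)"
    using assms len by (intro card_subset_eq pair_finite_arcs) (simp_all add: card_parcs_cycle_on)
  moreover have "pverts (cycle_on ys) = pverts (cycle_on xs)" using assms(3) by (simp add: cycle_on_def)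
  ultimately show ?thesis by simp
qed

lemma closed_cycle_on:
  assumes "xs \<noteq> []" shows "successively (adj (cycle_on xs)) (xs @ [hd xs])"
  unfolding successively_closed_nth[OF assms] by (auto simp: adj_cycle_on)

lemma cycle_on_rotate:
  assumes "distinct xs" "3 \<le> length xs"
  shows "cycle_on (rotate m xs) = cycle_on xs"
proof -
  have "xs \<noteq> []" using assms(2) by auto
  then show ?thesis
    using assms by (intro cycle_on_eq_if_closed successively_closed_rotate closed_cycle_on) auto
qed

lemma cycle_on_rev:
  assumes "distinct xs" "3 \<le> length xs"
  shows "cycle_on (rev xs) = cycle_on xs"
proof (rule cycle_on_eq_if_closed[OF assms(1) _ _ assms(2)])
  have ne: "xs \<noteq> []" using assms(2) by auto
  have sym: "adj (cycle_on xs) v u" if "adj (cycle_on xs) u v" for u v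
    using that by (auto simp: adj_cycle_on)
  have "successively (adj (cycle_on xs)) xs" "adj (cycle_on xs) (last xs) (hd xs)"
    using closed_cycle_on[OF ne] ne by (auto simp: successively_append_iff)
  then have "successively (adj (cycle_on xs)) (last xs # xs)"
    using ne by (simp add: successively_Cons)
  then have "successively (\<lambda>u v. adj (cycle_on xs) v u) (rev (last xs # xs))"
    by (simp only: successively_rev)
  then have "successively (adj (cycle_on xs)) (rev (last xs # xs))"
    by (rule successively_mono) (rule sym)
  then show "successively (adj (cycle_on xs)) (rev xs @ [hd (rev xs)])" using ne by (simp add: hd_rev)
qed (use assms in auto)

lemma adj_cycle_on_inner:
  assumes "distinct xs" "Suc (Suc j) < length xs"
  shows "adj (cycle_on xs) (xs ! Suc j) w \<longleftrightarrow> w = xs ! j \<or> w = xs ! Suc (Suc j)"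
proof
  assume "adj (cycle_on xs) (xs ! Suc j) w"
  then obtain i where i: "i < length xs" "(xs ! Suc j = xs ! i \<and> w = xs ! (Suc i mod length xs)) \<or>
     (w = xs ! i \<and> xs ! Suc j = xs ! (Suc i mod length xs))"
    by (auto simp: adj_cycle_on)
  have lt: "Suc i mod length xs < length xs" using i(1) by (intro mod_less_divisor) auto
  from i(2) show "w = xs ! j \<or> w = xs ! Suc (Suc j)"
  proof
    assume a: "xs ! Suc j = xs ! i \<and> w = xs ! (Suc i mod length xs)"
    then have "i = Suc j" using assms i(1) by (metis Suc_lessD nth_eq_iff_index_eq)
    then show ?thesis using a assms by simp
  next
    assume a: "w = xs ! i \<and> xs ! Suc j = xs ! (Suc i mod length xs)"
    then have "Suc i mod length xs = Suc j" using assms lt by (metis Suc_lessD nth_eq_iff_index_eq)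
    then have "i = j" using i(1) by (cases "Suc i = length xs") auto
    then show ?thesis using a by simp
  qed
next
  assume "w = xs ! j \<or> w = xs ! Suc (Suc j)"
  then show "adj (cycle_on xs) (xs ! Suc j) w"
  proof
    assume "w = xs ! j"
    then show ?thesis using assms(2) unfolding adj_cycle_on by (intro exI[of _ j]) auto
  next
    assume "w = xs ! Suc (Suc j)"
    then show ?thesis using assms(2) unfolding adj_cycle_on by (intro exI[of _ "Suc j"]) auto
  qed
qed

text \<open>
  Every vertex of a cycle has just two neighbours. So each entry of the sequence, from the third
  one on, is the neighbour of its predecessor that has not just been visited.
\<close>

lemma cycle_on_determined:
  assumes "distinct xs" "distinct ys" "length xs = length ys" "cycle_on xs = cycle_on ys"
    and "xs ! 0 = ys ! 0" "xs ! 1 = ys ! 1"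
  shows "xs = ys"
proof (rule nth_equalityI)
  have *: "Suc i < length xs \<Longrightarrow> xs ! i = ys ! i \<and> xs ! Suc i = ys ! Suc i" for i
  proof (induction i)
    case 0
    then show ?case using assms by simp
  next
    case (Suc i)
    then have IH: "xs ! i = ys ! i" "xs ! Suc i = ys ! Suc i" by auto
    have "{xs ! i, xs ! Suc (Suc i)} = {w. adj (cycle_on xs) (xs ! Suc i) w}"
      using adj_cycle_on_inner[OF assms(1) Suc.prems] by auto
    also have "\<dots> = {ys ! i, ys ! Suc (Suc i)}"
      using adj_cycle_on_inner[OF assms(2), of i] Suc.prems assms(3,4) IH by auto
    finally show ?case using IH by (metis doubleton_eq_iff)
  qed
  show "xs ! i = ys ! i" if "i < length xs" for i
    using *[of "i - 1"] that assms(5) by (cases i) auto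
qed (rule assms(3))

text \<open>
  A sequence that traces a given cycle is determined by its first arc, and each of the \<open>2 k\<close> arcs
  occurs: rotations give one direction, reversals the other.
\<close>

lemma card_cycle_on_fibre:
  assumes "distinct xs" "3 \<le> length xs"
  shows "card {ys. distinct ys \<and> length ys = length xs \<and> cycle_on ys = cycle_on xs} = 2 * length xs"
    (is "card ?F = _")
proof -
  let ?p = "\<lambda>ys. (ys ! 0, ys ! 1)"
  have inj: "inj_on ?p ?F"
  proof (rule inj_onI)
    fix ys zs assume "ys \<in> ?F" "zs \<in> ?F" "?p ys = ?p zs"
    then show "ys = zs" by (intro cycle_on_determined) simp_all
  qed
  have img: "?p ` ?F = parcs (cycle_on xs)"
  proof (intro equalityI subsetI)
    fix e assume "e \<in> ?p ` ?F"
    then obtain ys where ys: "e = ?p ys" "ys \<in> ?F" by blast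
    have "adj (cycle_on ys) (ys ! 0) (ys ! 1)"
      using ys(2) assms(2) unfolding adj_cycle_on by (intro exI[of _ 0]) auto
    then show "e \<in> parcs (cycle_on xs)" using ys by auto
  next
    fix e assume e: "e \<in> parcs (cycle_on xs)"
    obtain u v where uv: "e = (u, v)" by (cases e)
    from e obtain i where i: "i < length xs"
      "(u = xs ! i \<and> v = xs ! (Suc i mod length xs)) \<or> (v = xs ! i \<and> u = xs ! (Suc i mod length xs))"
      by (auto simp: uv adj_cycle_on)
    define zs where "zs = rotate i xs"
    have zs: "distinct zs" "length zs = length xs" "cycle_on zs = cycle_on xs"
      using assms cycle_on_rotate by (auto simp: zs_def)
    have "zs ! 0 = xs ! i" using i(1) assms(2) unfolding zs_def by (subst nth_rotate) auto
    moreover have "zs ! 1 = xs ! (Suc i mod length xs)"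
      using assms(2) unfolding zs_def by (subst nth_rotate) auto
    ultimately consider "?p zs = e" | "e = (zs ! 1, zs ! 0)" using i(2) uv by auto
    then show "e \<in> ?p ` ?F"
    proof cases
      case 1
      then show ?thesis using zs by (intro rev_image_eqI[of zs]) auto
    next
      case 2
      \<comment> \<open>The reversed sequence ends with \<open>zs ! 1\<close>, \<open>zs ! 0\<close>; this rotation moves them to the front.\<close>
      define ws where "ws = rotate (length xs - 2) (rev zs)"
      have "cycle_on ws = cycle_on xs"
        using cycle_on_rotate[of "rev zs"] cycle_on_rev[of zs] zs assms(2) by (simp add: ws_def)
      moreover have "ws ! 0 = zs ! 1"
        using zs assms(2) unfolding ws_def by (subst nth_rotate) (auto simp: rev_nth)
      moreover have "ws ! 1 = zs ! 0"
      proof -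
        have "(length xs - 2 + 1) mod length xs = length xs - 1" using assms(2) by simp
        then show ?thesis using zs assms(2) unfolding ws_def by (subst nth_rotate) (auto simp: rev_nth)
      qed
      ultimately show ?thesis using 2 zs by (intro rev_image_eqI[of ws]) (auto simp: ws_def)
    qed
  qed
  show ?thesis using card_image[OF inj] card_parcs_cycle_on[OF assms] unfolding img by simp
qed

theorem card_closed_seqs_eq_copies:
  assumes G: "pair_graph G" and k: "3 \<le> k"
  shows "card (closed_seqs (adj G) (pverts G) k) = 2 * k * card (copies (cycle_graph k) G)"
proof -
  let ?C = "closed_seqs (adj G) (pverts G) k"
  have sym: "symp (adj G)" using G by (auto simp: pair_graph_iff symp_def)
  have fin: "finite ?C"
    by (rule finite_subset[OF _ finite_lists_length_eq[of "pverts G" k]])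
      (use G in \<open>auto simp: closed_seqs_def pair_graph_iff\<close>)
  have "card ?C = (\<Sum>S\<in>cycle_on ` ?C. card {xs \<in> ?C. cycle_on xs = S})"
    using sum.image_gen[OF fin, of "\<lambda>_. 1 :: nat" cycle_on] by simp
  also have "\<dots> = (\<Sum>S\<in>cycle_on ` ?C. 2 * k)"
  proof (rule sum.cong[OF refl])
    fix S assume "S \<in> cycle_on ` ?C"
    then obtain xs where S: "S = cycle_on xs" and xs: "xs \<in> ?C" by blast
    have "ys \<in> ?C" if "distinct ys" "length ys = length xs" "cycle_on ys = cycle_on xs" for ys
    proof -
      have "set ys = set xs" using arg_cong[OF that(3), of pverts] by (simp add: cycle_on_def)
      moreover have "xs \<noteq> []" "ys \<noteq> []" using xs k that(2) by (auto simp: closed_seqs_def)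
      then have "successively (adj G) (ys @ [hd ys])"
        using xs that(3) closed_iff_cycle_on[OF _ sym] by (auto simp: closed_seqs_def)
      ultimately show ?thesis using xs that by (auto simp: closed_seqs_def)
    qed
    then have "{ys \<in> ?C. cycle_on ys = S}
        = {ys. distinct ys \<and> length ys = length xs \<and> cycle_on ys = cycle_on xs}"
      using xs S by (auto simp: closed_seqs_def)
    then show "card {ys \<in> ?C. cycle_on ys = S} = 2 * k"
      using card_cycle_on_fibre[of xs] xs k by (simp add: closed_seqs_def)
  qed
  finally show ?thesis using copies_cycle_graph[OF G k] by simp
qed

section \<open>The extremal graphs\<close>

text \<open>
  The common description of \<open>K\<^bsub>n-1\<^esub> \<cdot> K\<^sub>2\<close> and \<open>K\<^bsub>n-1\<^esub> \<union> K\<^sub>1\<close>, for which \<open>x\<close> has degree 1 and 0, respectively.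
\<close>

definition near_complete :: "'a pair_pre_digraph \<Rightarrow> bool" where
  "near_complete G \<longleftrightarrow> (\<exists>x\<in>pverts G. degree (adj G) (pverts G) x \<le> 1 \<and>
     (\<forall>u\<in>pverts G - {x}. \<forall>v\<in>pverts G - {x}. u \<noteq> v \<longrightarrow> adj G u v))"

lemma pair_graph_adj:
  assumes "pair_graph G"
  shows "symp (adj G)" "irreflp (adj G)" "finite (pverts G)"
  using assms by (auto simp: pair_graph_iff symp_def irreflp_def)

lemma graph_isoI:
  assumes "pair_graph G" "pair_graph H" "bij_betw f (pverts G) (pverts H)"
    and "\<And>u v. u \<in> pverts G \<Longrightarrow> v \<in> pverts G \<Longrightarrow> (u, v) \<in> parcs G \<longleftrightarrow> (f u, f v) \<in> parcs H"
  shows "graph_iso G H"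
proof -
  have "pair_wf_digraph G" "pair_wf_digraph H"
    using assms(1,2) by (auto simp: pair_graph_iff pair_wf_digraph_iff)
  then show ?thesis using assms(3,4) graph_iso_iff by blast
qed

lemma graph_isoE:
  assumes "graph_iso G H" "pair_graph H"
  obtains f where "bij_betw f (pverts G) (pverts H)"
    "\<And>u v. u \<in> pverts G \<Longrightarrow> v \<in> pverts G \<Longrightarrow> (u, v) \<in> parcs G \<longleftrightarrow> (f u, f v) \<in> parcs H"
proof -
  have "pair_wf_digraph H" using assms(2) by (auto simp: pair_graph_iff pair_wf_digraph_iff)
  then show ?thesis using assms(1) that by (auto simp: graph_iso_iff)
qed

lemma near_complete_iso:
  assumes iso: "graph_iso G H" and H: "pair_graph H" "near_complete H"
  shows "near_complete G"
proof -
  obtain f where f: "bij_betw f (pverts G) (pverts H)"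
    "\<And>u v. u \<in> pverts G \<Longrightarrow> v \<in> pverts G \<Longrightarrow> adj G u v \<longleftrightarrow> adj H (f u) (f v)"
    using graph_isoE[OF iso H(1)] by blast
  obtain y where y: "y \<in> pverts H" "degree (adj H) (pverts H) y \<le> 1"
    "\<forall>u\<in>pverts H - {y}. \<forall>v\<in>pverts H - {y}. u \<noteq> v \<longrightarrow> adj H u v"
    using H(2) unfolding near_complete_def by blast
  have "y \<in> f ` pverts G" using y(1) bij_betw_imp_surj_on[OF f(1)] by simp
  then obtain x where x: "x \<in> pverts G" "f x = y" by blast
  have inj: "inj_on f (pverts G)" and mem: "\<And>u. u \<in> pverts G \<Longrightarrow> f u \<in> pverts H"
    using f(1) by (auto simp: bij_betw_def)
  have "degree (adj G) (pverts G) x \<le> degree (adj H) (pverts H) y"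
    unfolding degree_def
  proof (rule card_inj_on_le)
    show "inj_on f {u \<in> pverts G. adj G x u}" by (rule inj_on_subset[OF inj]) auto
    show "f ` {u \<in> pverts G. adj G x u} \<subseteq> {u \<in> pverts H. adj H y u}" using f(2) x mem by auto
    show "finite {u \<in> pverts H. adj H y u}" using pair_graph_adj(3)[OF H(1)] by simp
  qed
  moreover have "adj G u v" if "u \<in> pverts G - {x}" "v \<in> pverts G - {x}" "u \<noteq> v" for u v
  proof -
    have "f u \<noteq> f v" "f u \<noteq> y" "f v \<noteq> y" using that x inj by (auto simp: inj_on_eq_iff)
    then show ?thesis using f(2) y(3) mem that by simp
  qed
  ultimately show ?thesis using x(1) y(2) unfolding near_complete_def by (intro bexI[of _ x] conjI ballI impI) auto
qed

lemma k23_like_iso: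
  assumes iso: "graph_iso G H" and H: "pair_graph H" "k23_like (adj H) (pverts H)"
  shows "k23_like (adj G) (pverts G)"
proof -
  obtain f where f: "bij_betw f (pverts G) (pverts H)"
    "\<And>u v. u \<in> pverts G \<Longrightarrow> v \<in> pverts G \<Longrightarrow> adj G u v \<longleftrightarrow> adj H (f u) (f v)"
    using graph_isoE[OF iso H(1)] by blast
  obtain I T where IT: "pverts H = I \<union> T" "I \<inter> T = {}" "card I = 3" "card T = 2"
    "\<And>x t. x \<in> I \<Longrightarrow> t \<in> T \<Longrightarrow> adj H x t" "\<And>x y. x \<in> I \<Longrightarrow> y \<in> I \<Longrightarrow> \<not> adj H x y"
    using H(2) by (auto simp: k23_like_def)
  define J where "J = {u \<in> pverts G. f u \<in> I}"
  define S where "S = {u \<in> pverts G. f u \<in> T}"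
  have im: "f ` pverts G = pverts H" and inj: "inj_on f (pverts G)" using f(1) by (auto simp: bij_betw_def)
  have "f ` J = I" "f ` S = T" using im IT(1) by (auto simp: J_def S_def)
  moreover have "inj_on f J" "inj_on f S" by (auto intro: inj_on_subset[OF inj] simp: J_def S_def)
  ultimately have "card J = 3" "card S = 2" using IT(3,4) by (metis card_image)+
  moreover have "pverts G = J \<union> S" "J \<inter> S = {}" using im IT(1,2) by (auto simp: J_def S_def)
  moreover have "\<forall>x\<in>J. \<forall>t\<in>S. adj G x t" "\<forall>x\<in>J. \<forall>y\<in>J. \<not> adj G x y"
    using f(2) IT(5,6) by (auto simp: J_def S_def)
  ultimately show ?thesis unfolding k23_like_def by blast
qed

lemma pverts_pendant: "1 \<le> m \<Longrightarrow> pverts (complete_pendant m) = insert (Inr 1) (Inl ` {..<m})"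
  by (auto simp: complete_pendant_def identify_vertices_def disjoint_union_def complete_graph_def
      Let_def image_Un image_image Plus_def less_2_cases_iff)

lemma parcs_pendant: "1 \<le> m \<Longrightarrow> parcs (complete_pendant m)
    = {(Inl u, Inl v) | u v. u < m \<and> v < m \<and> u \<noteq> v} \<union> {(Inl 0, Inr 1), (Inr 1, Inl 0)}"
proof -
  have *: "{(u, v). u < (2::nat) \<and> v < 2 \<and> u \<noteq> v} = {(0, 1), (1, 0)}"
    by (auto simp: less_2_cases_iff)
  show ?thesis
    unfolding complete_pendant_def identify_vertices_def disjoint_union_def complete_graph_def Let_def
    by (simp add: * image_Un image_image) (auto simp: image_iff)
qed

lemma pair_graph_pendant:
  assumes "1 \<le> m"
  shows "pair_graph (complete_pendant m)" and "card (pverts (complete_pendant m)) = m + 1"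
  using assms by (auto simp: pair_graph_iff pverts_pendant parcs_pendant card_image card_insert_if)

lemma near_complete_pendant:
  assumes "1 \<le> m"
  shows "near_complete (complete_pendant m)"
proof -
  have "{u \<in> pverts (complete_pendant m). adj (complete_pendant m) (Inr 1) u} = {Inl 0}"
    using assms by (auto simp: pverts_pendant parcs_pendant)
  then have "degree (adj (complete_pendant m)) (pverts (complete_pendant m)) (Inr 1) \<le> 1"
    by (simp add: degree_def)
  then show ?thesis unfolding near_complete_def using assms
    by (intro bexI[of _ "Inr 1"]) (auto simp: pverts_pendant parcs_pendant)
qed

definition complete_isolated :: "nat \<Rightarrow> (nat + nat) pair_pre_digraph" where
  "complete_isolated m = disjoint_union (complete_graph m) (complete_graph 1)"

lemma pverts_isolated: "pverts (complete_isolated m) = insert (Inr 0) (Inl ` {..<m})"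
  by (auto simp: complete_isolated_def disjoint_union_def complete_graph_def)

lemma parcs_isolated: "parcs (complete_isolated m) = {(Inl u, Inl v) | u v. u < m \<and> v < m \<and> u \<noteq> v}"
  by (auto simp: complete_isolated_def disjoint_union_def complete_graph_def image_iff)

lemma pair_graph_isolated:
  "pair_graph (complete_isolated m)" "card (pverts (complete_isolated m)) = m + 1"
  by (auto simp: pair_graph_iff pverts_isolated parcs_isolated card_image card_insert_if)

lemma near_complete_isolated: "near_complete (complete_isolated m)"
proof -
  have "degree (adj (complete_isolated m)) (pverts (complete_isolated m)) (Inr 0) \<le> 1"
    by (auto simp: degree_def parcs_isolated)
  then show ?thesis unfolding near_complete_def
    by (intro bexI[of _ "Inr 0"]) (auto simp: pverts_isolated parcs_isolated)
qed

text \<open>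
  The exceptional vertex \<open>x\<close> is mapped to the right summand. If it has a neighbour \<open>y\<close>, then the
  bijection on the complete part is chosen so that \<open>y\<close> goes to 0, the vertex of attachment.
\<close>

lemma near_complete_cases:
  assumes G: "pair_graph G" and n: "2 \<le> card (pverts G)" and nc: "near_complete G"
  shows "graph_iso G (complete_pendant (card (pverts G) - 1)) \<or>
    graph_iso G (complete_isolated (card (pverts G) - 1))"
proof -
  define V where "V = pverts G"
  define m where "m = card V - 1"
  have fin: "finite V" using pair_graph_adj(3)[OF G] by (simp add: V_def)
  have m: "1 \<le> m" using n by (simp add: m_def V_def)
  obtain x where x: "x \<in> V" "degree (adj G) V x \<le> 1"
    and "\<forall>u\<in>V - {x}. \<forall>v\<in>V - {x}. u \<noteq> v \<longrightarrow> adj G u v"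
    using nc unfolding near_complete_def V_def by blast
  then have complete: "adj G u v" if "u \<in> V - {x}" "v \<in> V - {x}" "u \<noteq> v" for u v
    using that by blast
  have irr: "\<not> adj G u u" for u using G by (auto simp: pair_graph_iff)
  have sym: "adj G u v \<longleftrightarrow> adj G v u" for u v using G by (auto simp: pair_graph_iff)
  have cx: "card (V - {x}) = m" using x fin by (simp add: m_def)
  show ?thesis
  proof (cases "\<exists>y\<in>V. adj G x y")
    case False
    obtain g where g: "bij_betw g (V - {x}) {..<m}"
      using finite_same_card_bij[of "V - {x}" "{..<m}"] fin cx by auto
    define f where "f u = (if u = x then Inr 0 else Inl (g u) :: nat + nat)" for u
    have "bij_betw f V (pverts (complete_isolated m))"
      unfolding pverts_isolated
    proof (rule bij_betw_imageI)
      have "f ` V = insert (f x) (f ` (V - {x}))" using x(1) by auto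
      also have "f ` (V - {x}) = Inl ` g ` (V - {x})" by (auto simp: f_def image_image)
      finally show "f ` V = insert (Inr 0) (Inl ` {..<m})"
        using g by (simp add: f_def bij_betw_def)
      show "inj_on f V" using g by (auto simp: inj_on_def f_def bij_betw_def)
    qed
    moreover have "adj G u v \<longleftrightarrow> (f u, f v) \<in> parcs (complete_isolated m)" if uv: "u \<in> V" "v \<in> V" for u v
    proof (cases "u = x \<or> v = x")
      case True
      then show ?thesis using False uv sym[of u v] unfolding parcs_isolated by (auto simp: f_def)
    next
      case nx: False
      then have "g u < m" "g v < m" "g u = g v \<longleftrightarrow> u = v"
        using g uv by (auto simp: bij_betw_def inj_on_eq_iff)
      then show ?thesis using nx uv complete[of u v] irr unfolding parcs_isolated by (auto simp: f_def)
    qed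
    ultimately have "graph_iso G (complete_isolated m)"
      using G pair_graph_isolated(1) by (intro graph_isoI[of _ _ f]) (auto simp: V_def)
    then show ?thesis by (simp add: m_def V_def)
  next
    case True
    then obtain y where y: "y \<in> V" "adj G x y" by blast
    have xy: "x \<noteq> y" using y irr by auto
    have only: "u = y" if "u \<in> V" "adj G x u" for u
    proof (rule ccontr)
      assume "u \<noteq> y"
      then have "card {u, y} = 2" by simp
      moreover have "card {u, y} \<le> degree (adj G) V x"
        unfolding degree_def using that y fin by (intro card_mono) auto
      ultimately show False using x(2) by simp
    qed
    have "card (V - {x} - {y}) = m - 1" using cx xy y(1) fin by simp
    then obtain g where g: "bij_betw g (V - {x} - {y}) {1..<m}"
      using finite_same_card_bij[of "V - {x} - {y}" "{1..<m}"] fin by auto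
    define h where "h u = (if u = y then 0 else g u)" for u
    have h: "bij_betw h (V - {x}) {..<m}"
    proof (rule bij_betw_imageI)
      have "V - {x} = insert y (V - {x} - {y})" using xy y by auto
      then have "h ` (V - {x}) = insert (h y) (h ` (V - {x} - {y}))" by (metis image_insert)
      also have "h ` (V - {x} - {y}) = g ` (V - {x} - {y})" by (auto simp: h_def)
      also have "insert (h y) (g ` (V - {x} - {y})) = {..<m}"
        using g m by (auto simp: h_def bij_betw_def)
      finally show "h ` (V - {x}) = {..<m}" .
      have g1: "g u \<noteq> 0" if "u \<in> V - {x} - {y}" for u using bspec[OF bij_betwE[OF g] that] by simp
      show "inj_on h (V - {x})"
      proof (rule inj_onI)
        fix u v assume uv: "u \<in> V - {x}" "v \<in> V - {x}" "h u = h v"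
        show "u = v"
        proof (cases "u = y \<or> v = y")
          case True
          then show ?thesis using uv g1[of u] g1[of v] by (auto simp: h_def split: if_splits)
        next
          case False
          then have "u \<in> V - {x} - {y}" "v \<in> V - {x} - {y}" "g u = g v" using uv by (auto simp: h_def)
          then show ?thesis using inj_onD[OF bij_betw_imp_inj_on[OF g]] by blast
        qed
      qed
    qed
    define f where "f u = (if u = x then Inr 1 else Inl (h u) :: nat + nat)" for u
    have "bij_betw f V (pverts (complete_pendant m))"
      unfolding pverts_pendant[OF m]
    proof (rule bij_betw_imageI)
      have "f ` V = insert (f x) (f ` (V - {x}))" using x(1) by auto
      also have "f ` (V - {x}) = Inl ` h ` (V - {x})" by (auto simp: f_def image_image)
      finally show "f ` V = insert (Inr 1) (Inl ` {..<m})"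
        using h by (simp add: f_def bij_betw_def)
      show "inj_on f V" using h by (auto simp: inj_on_def f_def bij_betw_def)
    qed
    moreover have "adj G u v \<longleftrightarrow> (f u, f v) \<in> parcs (complete_pendant m)" if uv: "u \<in> V" "v \<in> V" for u v
    proof -
      have h0: "h w = 0 \<longleftrightarrow> w = y" if "w \<in> V - {x}" for w
        using that inj_on_eq_iff[OF bij_betw_imp_inj_on[OF h], of w y] xy y(1) by (auto simp: h_def)
      consider "u = x" "v = x" | "u = x" "v \<noteq> x" | "u \<noteq> x" "v = x" | "u \<noteq> x" "v \<noteq> x" by blast
      then show ?thesis
      proof cases
        case 1
        then show ?thesis using irr unfolding parcs_pendant[OF m] by (simp add: f_def)
      next
        case 2
        then have "adj G u v \<longleftrightarrow> v = y" using only[OF uv(2)] y(2) by auto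
        then show ?thesis using 2 h0[of v] uv unfolding parcs_pendant[OF m] by (auto simp: f_def)
      next
        case 3
        then have "adj G u v \<longleftrightarrow> u = y" using only[OF uv(1)] y(2) sym[of u v] by auto
        then show ?thesis using 3 h0[of u] uv unfolding parcs_pendant[OF m] by (auto simp: f_def)
      next
        case 4
        then have "h u < m" "h v < m" "h u = h v \<longleftrightarrow> u = v"
          using h uv by (auto simp: bij_betw_def inj_on_eq_iff)
        then show ?thesis using 4 uv complete[of u v] irr unfolding parcs_pendant[OF m] by (auto simp: f_def)
      qed
    qed
    ultimately have "graph_iso G (complete_pendant m)"
      using G pair_graph_pendant(1)[OF m] by (intro graph_isoI[of _ _ f]) (auto simp: V_def)
    then show ?thesis by (simp add: m_def V_def)
  qed
qed

lemma near_complete_iff: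
  assumes n: "2 \<le> n"
  shows "pair_graph G \<and> card (pverts G) = n \<and> near_complete G \<longleftrightarrow>
    graph_iso G (complete_pendant (n - 1)) \<or> graph_iso G (complete_isolated (n - 1))"
proof
  assume "pair_graph G \<and> card (pverts G) = n \<and> near_complete G"
  then show "graph_iso G (complete_pendant (n - 1)) \<or> graph_iso G (complete_isolated (n - 1))"
    using near_complete_cases[of G] n by blast
next
  have m: "1 \<le> n - 1" using n by simp
  assume "graph_iso G (complete_pendant (n - 1)) \<or> graph_iso G (complete_isolated (n - 1))"
  then show "pair_graph G \<and> card (pverts G) = n \<and> near_complete G"
  proof
    assume iso: "graph_iso G (complete_pendant (n - 1))"
    note pg = pair_graph_pendant[OF m]
    show ?thesis
      using pair_graph_if_iso[OF iso pg(1)] near_complete_iso[OF iso pg(1) near_complete_pendant[OF m]] pg(2) n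
      by simp
  next
    assume iso: "graph_iso G (complete_isolated (n - 1))"
    note pg = pair_graph_isolated[of "n - 1"]
    show ?thesis
      using pair_graph_if_iso[OF iso pg(1)] near_complete_iso[OF iso pg(1) near_complete_isolated] pg(2) n
      by simp
  qed
qed

definition k2_join_3k1 :: "(nat + nat \<times> nat) pair_pre_digraph" where
  "k2_join_3k1 = graph_join (complete_graph 2) (multiple_graph 3 (complete_graph 1))"

lemma pverts_k2_join_3k1: "pverts k2_join_3k1 = Inl ` {..<2} \<union> Inr ` ({..<3} \<times> {0})"
  by (auto simp: k2_join_3k1_def graph_join_def disjoint_union_def multiple_graph_def complete_graph_def)

lemma parcs_k2_join_3k1: "parcs k2_join_3k1 = {(Inl 0, Inl 1), (Inl 1, Inl 0)}
    \<union> (Inl ` {..<2}) \<times> (Inr ` ({..<3} \<times> {0})) \<union> (Inr ` ({..<3} \<times> {0})) \<times> (Inl ` {..<2})"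
proof -
  have *: "{(u, v). u < (2::nat) \<and> v < 2 \<and> u \<noteq> v} = {(0, 1), (1, 0)}"
    by (auto simp: less_2_cases_iff)
  have "{..<1::nat} = {0}" by auto
  then show ?thesis
    by (simp add: k2_join_3k1_def graph_join_def disjoint_union_def multiple_graph_def complete_graph_def *)
qed

lemma pair_graph_k2_join_3k1: "pair_graph k2_join_3k1"
  unfolding pair_graph_iff pverts_k2_join_3k1 parcs_k2_join_3k1 by auto

lemma k23_like_k2_join_3k1: "k23_like (adj k2_join_3k1) (pverts k2_join_3k1)"
proof -
  define I where "I = (Inr ` ({..<3} \<times> {0}) :: (nat + nat \<times> nat) set)"
  define T where "T = (Inl ` {..<2} :: (nat + nat \<times> nat) set)"
  have "pverts k2_join_3k1 = I \<union> T" by (simp only: I_def T_def pverts_k2_join_3k1 Un_commute)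
  moreover have "card I = 3" "card T = 2" "I \<inter> T = {}" by (auto simp: I_def T_def card_image)
  moreover have "\<forall>x\<in>I. \<forall>t\<in>T. adj k2_join_3k1 x t" "\<forall>x\<in>I. \<forall>y\<in>I. \<not> adj k2_join_3k1 x y"
    by (auto simp: I_def T_def parcs_k2_join_3k1)
  ultimately show ?thesis unfolding k23_like_def by blast
qed

lemma k23_like_cases:
  assumes G: "pair_graph G" and K: "k23_like (adj G) (pverts G)"
  shows "complete_bipartite_digraph 2 3 (with_proj G) \<or> graph_iso G k2_join_3k1"
proof -
  obtain I T where IT: "pverts G = I \<union> T" "I \<inter> T = {}" "card I = 3" "card T = 2"
    "\<And>x t. x \<in> I \<Longrightarrow> t \<in> T \<Longrightarrow> adj G x t" "\<And>x y. x \<in> I \<Longrightarrow> y \<in> I \<Longrightarrow> \<not> adj G x y"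
    using K by (auto simp: k23_like_def)
  have wf: "u \<in> I \<union> T \<and> v \<in> I \<union> T \<and> u \<noteq> v \<and> adj G v u" if "adj G u v" for u v
    using that G IT(1) by (auto simp: pair_graph_iff)
  obtain p q where pq: "T = {p, q}" "p \<noteq> q" using IT(4) by (auto simp: card_2_iff)
  show ?thesis
  proof (cases "adj G p q")
    case False
    have "parcs G = T \<times> I \<union> I \<times> T"
    proof (intro equalityI subsetI)
      fix e assume e: "e \<in> parcs G"
      obtain u v where uv: "e = (u, v)" by (cases e)
      have "\<not> (u \<in> T \<and> v \<in> T)" using e wf[of u v] False pq by (auto simp: uv)
      moreover have "\<not> (u \<in> I \<and> v \<in> I)" using e IT(6) by (auto simp: uv)
      ultimately show "e \<in> T \<times> I \<union> I \<times> T" using wf[of u v] e by (auto simp: uv)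
    next
      fix e assume "e \<in> T \<times> I \<union> I \<times> T"
      then show "e \<in> parcs G" using IT(5) wf by blast
    qed
    moreover have "finite (pverts G)" by (rule pair_graph_adj(3)[OF G])
    moreover have "pverts G = T \<union> I" "T \<inter> I = {}" using IT(1,2) by auto
    ultimately have "complete_bipartite_digraph 2 3 (with_proj G)"
      unfolding complete_bipartite_digraph_pair_def using IT(3,4) by blast
    then show ?thesis ..
  next
    case True
    have finI: "finite I" using IT(3) by (auto intro: card_ge_0_finite)
    obtain g where g: "bij_betw g I {..<3::nat}"
      using finite_same_card_bij[of I "{..<3::nat}"] finI IT(3) by auto
    define f where "f u = (if u = p then Inl 0 else if u = q then Inl 1 else Inr (g u, 0) :: nat + nat \<times> nat)" for u
    have nI: "p \<notin> I" "q \<notin> I" using IT(2) pq by auto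
    have gI: "g u \<in> {..<3}" if "u \<in> I" for u using g that by (auto simp: bij_betw_def)
    have fI: "f u = Inr (g u, 0)" if "u \<in> I" for u using that nI by (auto simp: f_def)
    have fpq: "f p = Inl 0" "f q = Inl 1" using pq by (auto simp: f_def)
    have "bij_betw f (pverts G) (pverts k2_join_3k1)"
    proof (rule bij_betw_imageI)
      have "f ` I = (\<lambda>i. Inr (i, 0)) ` g ` I" using fI by (auto simp: image_image)
      also have "g ` I = {..<3}" using g by (simp add: bij_betw_def)
      finally have "f ` I = Inr ` ({..<3} \<times> {0})" by auto
      moreover have "f ` T = Inl ` {..<2}" using fpq pq by (auto simp: less_2_cases_iff)
      ultimately show "f ` pverts G = pverts k2_join_3k1"
        by (simp add: IT(1) image_Un pverts_k2_join_3k1 Un_commute)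
      have "inj_on f I" using g fI by (auto simp: inj_on_def bij_betw_def)
      then show "inj_on f (pverts G)" using fI fpq nI unfolding IT(1) pq(1) by (auto simp: inj_on_def)
    qed
    moreover have "adj G u v \<longleftrightarrow> (f u, f v) \<in> parcs k2_join_3k1" if uv: "u \<in> pverts G" "v \<in> pverts G" for u v
    proof -
      have qp: "adj G q p" using True wf by blast
      have TI: "adj G t w" "adj G w t" if "t \<in> T" "w \<in> I" for t w using IT(5) that wf by blast+
      have fT: "f t \<in> Inl ` {..<2}" if "t \<in> T" for t using that pq fpq by auto
      have fI': "f w \<in> Inr ` ({..<3} \<times> {0})" if "w \<in> I" for w using fI gI that by auto
      consider "u \<in> I" "v \<in> I" | "u \<in> I" "v \<in> T" | "u \<in> T" "v \<in> I" | "u \<in> T" "v \<in> T"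
        using uv IT(1) by blast
      then show ?thesis
      proof cases
        case 1
        then show ?thesis using IT(6) fI unfolding parcs_k2_join_3k1 by auto
      next
        case 2
        then show ?thesis using TI fT fI' unfolding parcs_k2_join_3k1 by blast
      next
        case 3
        then show ?thesis using TI fT fI' unfolding parcs_k2_join_3k1 by blast
      next
        case 4
        then show ?thesis using True qp fpq wf[of u u] unfolding parcs_k2_join_3k1 pq(1) by auto
      qed
    qed
    ultimately have "graph_iso G k2_join_3k1"
      using G pair_graph_k2_join_3k1 by (intro graph_isoI[of _ _ f]) auto
    then show ?thesis ..
  qed
qed

lemma k23_like_iff:
  "pair_graph G \<and> k23_like (adj G) (pverts G) \<longleftrightarrow>
     complete_bipartite_digraph 2 3 (with_proj G) \<or> graph_iso G k2_join_3k1"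
proof
  assume "pair_graph G \<and> k23_like (adj G) (pverts G)"
  then show "complete_bipartite_digraph 2 3 (with_proj G) \<or> graph_iso G k2_join_3k1"
    using k23_like_cases by blast
next
  assume "complete_bipartite_digraph 2 3 (with_proj G) \<or> graph_iso G k2_join_3k1"
  then show "pair_graph G \<and> k23_like (adj G) (pverts G)"
  proof
    assume iso: "graph_iso G k2_join_3k1"
    show ?thesis
      using pair_graph_if_iso(1)[OF iso pair_graph_k2_join_3k1]
        k23_like_iso[OF iso pair_graph_k2_join_3k1 k23_like_k2_join_3k1] by blast
  next
    assume b: "complete_bipartite_digraph 2 3 (with_proj G)"
    then obtain U W where UW: "pverts G = U \<union> W" "U \<inter> W = {}" "card U = 2" "card W = 3"
      "parcs G = U \<times> W \<union> W \<times> U"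
      unfolding complete_bipartite_digraph_pair_def by blast
    then have "k23_like (adj G) (pverts G)"
      unfolding k23_like_def by (intro exI[of _ W] exI[of _ U]) auto
    then show ?thesis using pair_graphI_complete_bipartite[OF b] by blast
  qed
qed

lemma copies_le:
  assumes G: "pair_graph G" "card (pverts G) = n" "graph_free (cycle_graph n) G"
    and k: "3 \<le> k" "k \<le> n - 1"
  shows "2 * k * card (copies (cycle_graph k) G) \<le> falling (n - 1) k"
proof -
  have "\<not> hamiltonian (adj G) (pverts G)"
    using graph_free_cycle_graph_iff[OF G(1)] G(2,3) k by simp
  then show ?thesis
    using card_closed_seqs_nonhamiltonian(1)[OF pair_graph_adj[OF G(1)], of k] k G(2)
      card_closed_seqs_eq_copies[OF G(1) k(1)] by simp
qed

lemma extremal_iff: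
  assumes k: "3 \<le> k" "k \<le> n - 1"
  shows "pair_graph G \<and> card (pverts G) = n \<and> graph_free (cycle_graph n) G \<and>
      2 * k * card (copies (cycle_graph k) G) = falling (n - 1) k \<longleftrightarrow>
    pair_graph G \<and> card (pverts G) = n \<and>
      (near_complete G \<or> (n = 5 \<and> k = 4 \<and> k23_like (adj G) (pverts G)))"
proof (cases "pair_graph G \<and> card (pverts G) = n")
  case True
  then have G: "pair_graph G" and n: "card (pverts G) = n" by auto
  show ?thesis
    using extremal_nonhamiltonian_iff[OF pair_graph_adj[OF G], of k] graph_free_cycle_graph_iff[OF G]
      card_closed_seqs_eq_copies[OF G k(1)] k G n
    unfolding near_complete_def by auto
qed blast

text \<open>
  The maximum is attained by \<open>K\<^bsub>n-1\<^esub> \<union> K\<^sub>1\<close> on the vertices \<open>0, \<dots>, n-1\<close> with \<open>n-1\<close> isolated.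
\<close>

lemma gen_turan_cycle:
  assumes k: "3 \<le> k" "k \<le> n - 1"
  shows "2 * k * gen_turan n (cycle_graph k) (cycle_graph n) = falling (n - 1) k"
proof -
  let ?M = "{card (copies (cycle_graph k) G) | G :: nat pair_pre_digraph.
            pair_graph G \<and> card (pverts G) = n \<and> graph_free (cycle_graph n) G}"
  let ?H = "\<lparr> pverts = {..<n}, parcs = {(u, v). u < n - 1 \<and> v < n - 1 \<and> u \<noteq> v} \<rparr>"
  have le: "2 * k * m \<le> falling (n - 1) k" if "m \<in> ?M" for m
    using that copies_le[OF _ _ _ k] by auto
  have "m \<le> falling (n - 1) k" if "m \<in> ?M" for m
  proof -
    have "m = 1 * m" by simp
    also have "\<dots> \<le> 2 * k * m" using k by (intro mult_le_mono1) simp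
    also have "\<dots> \<le> falling (n - 1) k" by (rule le[OF that])
    finally show ?thesis .
  qed
  then have fin: "finite ?M" by (intro finite_subset[of ?M "{..falling (n - 1) k}"]) auto
  have "pair_graph ?H" by (auto simp: pair_graph_iff)
  moreover have "near_complete ?H"
    unfolding near_complete_def
  proof (intro bexI[of _ "n - 1"] conjI)
    have none: "{u \<in> pverts ?H. adj ?H (n - 1) u} = {}" by auto
    show "degree (adj ?H) (pverts ?H) (n - 1) \<le> 1" unfolding degree_def none by simp
  qed (use k in auto)
  ultimately have H: "pair_graph ?H \<and> card (pverts ?H) = n \<and> graph_free (cycle_graph n) ?H \<and>
      2 * k * card (copies (cycle_graph k) ?H) = falling (n - 1) k"
    unfolding extremal_iff[OF k] by simp
  define m where "m = card (copies (cycle_graph k) ?H)"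
  have mM: "m \<in> ?M" using H unfolding m_def by blast
  have m: "2 * k * m = falling (n - 1) k" using H by (simp add: m_def)
  have "Max ?M = m"
  proof (rule Max_eqI[OF fin _ mM])
    fix y assume "y \<in> ?M"
    then have "2 * k * y \<le> 2 * k * m" using le m by simp
    then show "y \<le> m" using k by simp
  qed
  then show ?thesis using m by (simp add: gen_turan_def)
qed

lemma perm_count_eq_falling:
  assumes "1 \<le> m" "k \<le> m"
  shows "perm_count (int m) (int k) = real (falling m k)"
proof -
  have "real (falling m k) * fact (m - k) = fact m"
    using arg_cong[OF falling_mult_fact[OF assms(2)], of real] by simp
  moreover have "nat (int m - int k) = m - k" by simp
  ultimately show ?thesis using assms by (simp add: perm_count_def field_simps)
qed

theorem corollary3:
  fixes n k :: nat
  assumes "3 \<le> k" and "k \<le> n - 1"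
  shows "real (gen_turan n (cycle_graph k) (cycle_graph n))
           = perm_count (int n - 1) (int k) / (2 * real k)
    \<and> (\<forall>G :: 'a pair_pre_digraph.
         gen_turan_extremal n (cycle_graph k) (cycle_graph n) G \<longleftrightarrow>
           (if (n, k) \<noteq> (5, 4)
            then graph_iso G (complete_pendant (n - 1))
               \<or> graph_iso G (disjoint_union (complete_graph (n - 1)) (complete_graph 1))
            else graph_iso G (complete_pendant 4)
               \<or> graph_iso G (disjoint_union (complete_graph 4) (complete_graph 1))
               \<or> complete_bipartite_digraph 2 3 (with_proj G)
               \<or> graph_iso G (graph_join (complete_graph 2)
                                (multiple_graph 3 (complete_graph 1)))))"
proof (intro conjI allI)
  note turan = gen_turan_cycle[OF assms]
  have "2 * real k * real (gen_turan n (cycle_graph k) (cycle_graph n)) = real (falling (n - 1) k)"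
    using arg_cong[OF turan, of real] by simp
  moreover have "int n - 1 = int (n - 1)" using assms by simp
  then have "perm_count (int n - 1) (int k) = real (falling (n - 1) k)"
    using perm_count_eq_falling[of "n - 1" k] assms by simp
  ultimately show "real (gen_turan n (cycle_graph k) (cycle_graph n))
           = perm_count (int n - 1) (int k) / (2 * real k)"
    using assms by (simp add: field_simps)
next
  fix G :: "'a pair_pre_digraph"
  have "gen_turan_extremal n (cycle_graph k) (cycle_graph n) G \<longleftrightarrow>
    pair_graph G \<and> card (pverts G) = n \<and> graph_free (cycle_graph n) G \<and>
      2 * k * card (copies (cycle_graph k) G) = falling (n - 1) k"
    unfolding gen_turan_extremal_def gen_turan_cycle[OF assms, symmetric] using assms(1) by simp
  also have "\<dots> \<longleftrightarrow> pair_graph G \<and> card (pverts G) = n \<and>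
      (near_complete G \<or> (n = 5 \<and> k = 4 \<and> k23_like (adj G) (pverts G)))"
    by (rule extremal_iff[OF assms])
  also have "\<dots> \<longleftrightarrow> (pair_graph G \<and> card (pverts G) = n \<and> near_complete G) \<or>
      ((n, k) = (5, 4) \<and> pair_graph G \<and> k23_like (adj G) (pverts G))"
    using card_k23_like(1) by auto
  also have "\<dots> \<longleftrightarrow> (graph_iso G (complete_pendant (n - 1)) \<or> graph_iso G (complete_isolated (n - 1))) \<or>
      ((n, k) = (5, 4) \<and>
        (complete_bipartite_digraph 2 3 (with_proj G) \<or> graph_iso G k2_join_3k1))"
    using near_complete_iff[of n G] k23_like_iff[of G] assms by auto
  finally show "gen_turan_extremal n (cycle_graph k) (cycle_graph n) G \<longleftrightarrow>
           (if (n, k) \<noteq> (5, 4)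
            then graph_iso G (complete_pendant (n - 1))
               \<or> graph_iso G (disjoint_union (complete_graph (n - 1)) (complete_graph 1))
            else graph_iso G (complete_pendant 4)
               \<or> graph_iso G (disjoint_union (complete_graph 4) (complete_graph 1))
               \<or> complete_bipartite_digraph 2 3 (with_proj G)
               \<or> graph_iso G (graph_join (complete_graph 2)
                                (multiple_graph 3 (complete_graph 1))))"
    unfolding complete_isolated_def k2_join_3k1_def by auto
qed

end
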